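(* Let $1\le s<m$ be integers. Let $S$ be a connected $s$-dimensional smooth embedded submanifold of $\mathbb{R}^{m+1}$ and let $\mathcal{D}\supset TS$ be a smooth distribution of rank $m$ along $S$. If for each $p\in S$ the shape operator of $S$ in direction $n\in\mathcal{D}_p^{\perp}$, $n\neq 0$, is nonsingular, then the geometric Cauchy problem for rank-$s$ hypersurfaces of $\mathbb{R}^{m+1}$ with data $(S,\mathcal{D})$ has a solution.
   Context: A smooth distribution of rank $m$ along $S$ is a smooth rank-$m$ subbundle of the ambient tangent bundle $T\mathbb{R}^{m+1}|_{S}$; $\mathcal{D}\supset TS$ means $T_pS\subset\mathcal{D}_p$ for all $p\in S$. $\mathcal{D}_p^{\perp}$ is the (one-dimensional) orthogonal complement of $\mathcal{D}_p$ in $\mathbb{R}^{m+1}$. The shape operator of $S$ at $p$ in direction $n\in\mathcal{D}_p^\perp$ is the endomorphism of $T_pS$ given by $v\mapsto\pi_S(\nabla_vN)$, where $\nabla$ is the Euclidean connection, $N$ is any extension of $n$ to a local section of $\mathcal{D}^{\perp}$, and $\pi_S$ is orthogonal projection onto $T_pS$. For an $m$-dimensional smooth embedded submanifold $M$ of $\mathbb{R}^{m+1}$ (a hypersurface) with second fundamental form $\alpha$, the index of relative nullity at $p\in M$ is $\dim\{x\in T_pM\mid\alpha(x,\cdot)=0\}$. $M$ is rank-$s$ if its index of relative nullity equals $m-s$ at every point. Geometric Cauchy problem for rank-$s$ hypersurfaces with data $(S,\mathcal{D})$: find an $m$-dimensional rank-$s$ smooth embedded submanifold $M$ of $\mathbb{R}^{m+1}$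 with $S\subset M$ and $T_pM=\mathcal{D}_p$ for all $p\in S$. Such an $M$ is called a solution. *)

theory Defs
  imports "HOL-Analysis.Analysis"
begin

section \<open>Smooth maps\<close>

text \<open>Class \<open>C\<^sup>k\<close> on an open set of a finite-dimensional space: differentiable at every
  point, with every directional derivative of class \<open>C\<^sup>k\<^sup>-\<^sup>1\<close>. Only used for open sets.\<close>

primrec Ck_on :: "nat \<Rightarrow> 'a::real_normed_vector set \<Rightarrow> ('a \<Rightarrow> 'b::real_normed_vector) \<Rightarrow> bool" where
  "Ck_on 0 U f \<longleftrightarrow> continuous_on U f"
| "Ck_on (Suc k) U f \<longleftrightarrow>
     (\<forall>x\<in>U. f differentiable (at x)) \<and> (\<forall>v. Ck_on k U (\<lambda>x. frechet_derivative f (at x) v))"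

definition smooth_on :: "'a::real_normed_vector set \<Rightarrow> ('a \<Rightarrow> 'b::real_normed_vector) \<Rightarrow> bool" where
  "smooth_on U f \<longleftrightarrow> (\<forall>k. Ck_on k U f)"

text \<open>Smoothness on an arbitrary subset means existence of local smooth extensions to the ambient
  space; on an embedded submanifold this is smoothness in charts.\<close>

definition smooth_along :: "'a::real_normed_vector set \<Rightarrow> ('a \<Rightarrow> 'b::real_normed_vector) \<Rightarrow> bool" where
  "smooth_along X f \<longleftrightarrow>
     (\<forall>p\<in>X. \<exists>W g. open W \<and> p \<in> W \<and> smooth_on W g \<and> (\<forall>x\<in>X \<inter> W. g x = f x))"

section \<open>Embedded submanifolds and their tangent spaces\<close>

text \<open>\<open>\<phi> : U \<rightarrow> V\<close> is a slice chart: a diffeomorphism (with inverse \<open>\<psi>\<close>) of open sets of the ambient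
  space that flattens \<open>S\<close> onto a \<open>k\<close>-dimensional linear subspace \<open>L\<close>. The empty set is a submanifold
  of every dimension.\<close>

definition embedded_submanifold :: "nat \<Rightarrow> 'a::euclidean_space set \<Rightarrow> bool" where
  "embedded_submanifold k S \<longleftrightarrow>
     (\<forall>p\<in>S. \<exists>(U::'a set) (V::'a set) \<phi> \<psi> (L::'a set).
        open U \<and> p \<in> U \<and> open V \<and> homeomorphism U V \<phi> \<psi> \<and> smooth_on U \<phi> \<and> smooth_on V \<psi> \<and>
        subspace L \<and> dim L = k \<and> \<phi> ` (S \<inter> U) = L \<inter> V)"

definition curve_in :: "'a::euclidean_space set \<Rightarrow> 'a \<Rightarrow> 'a \<Rightarrow> (real \<Rightarrow> 'a) \<Rightarrow> bool" where
  "curve_in S p v \<gamma> \<longleftrightarrow>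
     (\<exists>\<epsilon>>0. smooth_on {-\<epsilon><..<\<epsilon>} \<gamma> \<and> \<gamma> ` {-\<epsilon><..<\<epsilon>} \<subseteq> S) \<and>
     \<gamma> 0 = p \<and> (\<gamma> has_vector_derivative v) (at 0)"

definition tangent_space :: "'a::euclidean_space set \<Rightarrow> 'a \<Rightarrow> 'a set" where
  "tangent_space S p = {v. \<exists>\<gamma>. curve_in S p v \<gamma>}"

section \<open>Distributions, sections and the Euclidean connection\<close>

text \<open>A distribution along \<open>S\<close> is a family of fibres \<open>D p\<close> (values outside \<open>S\<close> are irrelevant);
  since the fibres have dimension \<open>m\<close>, the spanning fields \<open>X 0, \<dots>, X (m - 1)\<close> form a local frame.\<close>

definition smooth_distribution :: "nat \<Rightarrow> 'a::euclidean_space set \<Rightarrow> ('a \<Rightarrow> 'a set) \<Rightarrow> bool" where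
  "smooth_distribution m S D \<longleftrightarrow>
     (\<forall>p\<in>S. subspace (D p) \<and> dim (D p) = m) \<and>
     (\<forall>p\<in>S. \<exists>U (X :: nat \<Rightarrow> 'a \<Rightarrow> 'a). open U \<and> p \<in> U \<and>
        (\<forall>i<m. smooth_along (S \<inter> U) (X i)) \<and>
        (\<forall>q\<in>S \<inter> U. D q = span ((\<lambda>i. X i q) ` {..<m})))"

text \<open>\<open>X\<close> restricts to a smooth section, over a neighbourhood of \<open>p\<close> in \<open>S\<close>, of the bundle
  with fibres \<open>E q\<close>.\<close>

definition local_section ::
  "'a::euclidean_space set \<Rightarrow> ('a \<Rightarrow> 'a set) \<Rightarrow> 'a \<Rightarrow> ('a \<Rightarrow> 'a) \<Rightarrow> bool" where
  "local_section S E p X \<longleftrightarrow>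
     (\<exists>U. open U \<and> p \<in> U \<and> smooth_along (S \<inter> U) X \<and> (\<forall>q\<in>S \<inter> U. X q \<in> E q))"

text \<open>\<open>\<nabla>\<^sub>v X\<close> at \<open>p\<close>, for \<open>X\<close> a vector field along \<open>S\<close> near \<open>p\<close> and \<open>v \<in> T\<^sub>pS\<close>: the derivative of \<open>X\<close>
  along any curve in \<open>S\<close> with velocity \<open>v\<close> at \<open>p\<close>.\<close>

definition covariant_derivative ::
  "'a::euclidean_space set \<Rightarrow> 'a \<Rightarrow> 'a \<Rightarrow> ('a \<Rightarrow> 'a) \<Rightarrow> 'a" where
  "covariant_derivative S p v X =
     (THE w. \<forall>\<gamma>. curve_in S p v \<gamma> \<longrightarrow> ((\<lambda>t. X (\<gamma> t)) has_vector_derivative w) (at 0))"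

definition orth_proj :: "'a::euclidean_space set \<Rightarrow> 'a \<Rightarrow> 'a" where
  "orth_proj W x = (THE w. w \<in> W \<and> x - w \<in> W\<^sup>\<bottom>)"

section \<open>Shape operator and second fundamental form\<close>

text \<open>In the next two definitions the choice of extension is immaterial: another extension with the
  same value at \<open>p\<close> gives the same result.\<close>

definition shape_operator ::
  "'a::euclidean_space set \<Rightarrow> ('a \<Rightarrow> 'a set) \<Rightarrow> 'a \<Rightarrow> 'a \<Rightarrow> 'a \<Rightarrow> 'a" where
  "shape_operator S D p n v =
     (let N = (SOME N. local_section S (\<lambda>q. (D q)\<^sup>\<bottom>) p N \<and> N p = n)
      in orth_proj (tangent_space S p) (covariant_derivative S p v N))"

text \<open>\<open>\<alpha>(x, y)\<close> is the component normal to \<open>M\<close> of \<open>\<nabla>\<^sub>x Y\<close>, where the tangent field \<open>Y\<close> extends \<open>y\<close>.\<close>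

definition second_fundamental_form :: "'a::euclidean_space set \<Rightarrow> 'a \<Rightarrow> 'a \<Rightarrow> 'a \<Rightarrow> 'a" where
  "second_fundamental_form M p x y =
     (let Y = (SOME Y. local_section M (tangent_space M) p Y \<and> Y p = y)
      in orth_proj ((tangent_space M p)\<^sup>\<bottom>) (covariant_derivative M p x Y))"

definition index_of_relative_nullity :: "'a::euclidean_space set \<Rightarrow> 'a \<Rightarrow> nat" where
  "index_of_relative_nullity M p =
     dim {x \<in> tangent_space M p. \<forall>y\<in>tangent_space M p. second_fundamental_form M p x y = 0}"

section \<open>The geometric Cauchy problem\<close>

definition rank_hypersurface :: "nat \<Rightarrow> nat \<Rightarrow> 'a::euclidean_space set \<Rightarrow> bool" where
  "rank_hypersurface m s M \<longleftrightarrow>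
     embedded_submanifold m M \<and> (\<forall>p\<in>M. index_of_relative_nullity M p = m - s)"

definition geometric_Cauchy_solution ::
  "nat \<Rightarrow> nat \<Rightarrow> 'a::euclidean_space set \<Rightarrow> ('a \<Rightarrow> 'a set) \<Rightarrow> 'a set \<Rightarrow> bool" where
  "geometric_Cauchy_solution m s S D M \<longleftrightarrow>
     rank_hypersurface m s M \<and> S \<subseteq> M \<and> (\<forall>p\<in>S. tangent_space M p = D p)"

end

theory Submission
  imports Defs
begin

text \<open>Let \<open>N\<close> be a local unit normal field of \<open>D\<close> and let \<open>K p = {w. \<forall>v\<in>T\<^sub>pS. w \<bullet> dN\<^sub>p v = 0}\<close>, which does
  not depend on \<open>N\<close>. Nonsingularity of the shape operator means that \<open>K p\<close> is a complement of \<open>T\<^sub>pS\<close>, so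
  the affine spaces \<open>p + K p\<close> are the fibres of a smooth retraction \<open>P\<close> of a neighbourhood of \<open>S\<close>
  onto \<open>S\<close>. The function \<open>g x = (x - P x) \<bullet> N (P x)\<close> has gradient exactly \<open>N (P x)\<close>: the term
  \<open>dP x \<bullet> N\<close> vanishes because \<open>TS \<subseteq> D\<close>, and the derivative of \<open>N \<circ> P\<close> is orthogonal to \<open>x - P x\<close>.
  Hence \<open>M = {g = 0}\<close> is a hypersurface with unit normal \<open>N \<circ> P\<close>, which is tangent to \<open>D\<close> along \<open>S\<close>,
  and its relative nullity at \<open>x\<close> is \<open>K (P x) \<inter> D (P x)\<close>, of dimension \<open>m - s\<close>.\<close>

section \<open>Calculus of functions of class \<open>C\<^sup>k\<close>\<close>

text \<open>Nonsingularity enters through the bilinear form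
  \<open>(t, v) \<mapsto> t \<bullet> dN v\<close> on the tangent space of \<open>S\<close>, and it
  enters twice. Nondegeneracy in \<open>t\<close> lets the implicit function theorem solve for the
  foot point. Nondegeneracy in \<open>v\<close> makes \<open>dN\<close> injective on the tangent
  space, so that \<open>N \<circ> P\<close> and \<open>P\<close> have derivatives with the same
  kernel \<open>K (P x)\<close>; this holds at every point of the neighbourhood, and so fixes the
  nullity away from \<open>S\<close> too. The obstacle is to pass from local to global:
  \<open>D\<close> may have no global unit normal, and foot points are obtained only near each
  \<open>p\<close>. Each local solution therefore carries a uniqueness statement about points of
  \<open>S\<close> within a fixed radius, phrased without charts. It makes foot points agree on
  overlaps. Smoothness is defined by iterated derivatives in constant directions. Both the normal
  field and the inverse function are shown smooth as solutions of linear systems with coefficients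
  of class \<open>C\<^sup>k\<close>.\<close>

abbreviation fderiv :: "('a::real_normed_vector \<Rightarrow> 'b::real_normed_vector) \<Rightarrow> 'a \<Rightarrow> 'a \<Rightarrow> 'b" where
  "fderiv f x \<equiv> frechet_derivative f (at x)"

lemma fderiv_eqI: "(f has_derivative f') (at x) \<Longrightarrow> fderiv f x = f'"
  by (metis frechet_derivative_at)

lemma Ck_on_SucI:
  assumes "\<And>x. x \<in> U \<Longrightarrow> f differentiable (at x)" "\<And>v. Ck_on k U (\<lambda>x. fderiv f x v)"
  shows "Ck_on (Suc k) U f"
  using assms by simp

lemma Ck_on_subset: "Ck_on k U f \<Longrightarrow> V \<subseteq> U \<Longrightarrow> Ck_on k V f"
  by (induction k arbitrary: f) (auto intro: continuous_on_subset)

lemma Ck_on_SucD: "Ck_on (Suc k) U f \<Longrightarrow> Ck_on k U f"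
proof (induction k arbitrary: f)
  case 0
  then show ?case
    by (auto intro!: continuous_at_imp_continuous_on differentiable_imp_continuous_within)
next
  case (Suc k)
  show ?case
  proof (rule Ck_on_SucI)
    show "f differentiable at x" if "x \<in> U" for x
      using Suc.prems that by simp
    show "Ck_on k U (\<lambda>x. fderiv f x v)" for v
      using Suc.prems by (intro Suc.IH) simp
  qed
qed

text \<open>On an open set, agreement of two functions forces agreement of their derivatives, so a
  map may be replaced by any formula valid on \<open>U\<close> only.\<close>

lemma Ck_on_cong:
  assumes "open U" "\<And>x. x \<in> U \<Longrightarrow> f x = g x" "Ck_on k U f"
  shows "Ck_on k U g"
  using assms(2,3)
proof (induction k arbitrary: f g)
  case 0
  then show ?case using continuous_on_cong by fastforce
next
  case (Suc k)
  have der: "(g has_derivative fderiv f x) (at x)" if "x \<in> U" for x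
  proof (rule has_derivative_transform_within_open[OF _ \<open>open U\<close> that])
    show "(f has_derivative fderiv f x) (at x)"
      using Suc.prems that by (auto simp flip: frechet_derivative_works)
  qed (use Suc.prems in auto)
  show ?case
  proof (rule Ck_on_SucI)
    show "g differentiable at x" if "x \<in> U" for x
      using der[OF that] by (rule differentiableI)
    fix v
    show "Ck_on k U (\<lambda>x. fderiv g x v)"
      by (rule Suc.IH[where f = "\<lambda>x. fderiv f x v"]) (use Suc.prems fderiv_eqI[OF der] in auto)
  qed
qed

lemma Ck_on_SucI':
  assumes "open U" "\<And>x. x \<in> U \<Longrightarrow> (f has_derivative f' x) (at x)" "\<And>v. Ck_on k U (\<lambda>x. f' x v)"
  shows "Ck_on (Suc k) U f"
proof (rule Ck_on_SucI)
  show "f differentiable at x" if "x \<in> U" for x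
    using assms(2)[OF that] by (rule differentiableI)
  show "Ck_on k U (\<lambda>x. fderiv f x v)" for v
    by (rule Ck_on_cong[OF assms(1) _ assms(3)[of v]]) (use fderiv_eqI[OF assms(2)] in auto)
qed

lemma Ck_on_has_derivative:
  "Ck_on (Suc k) U f \<Longrightarrow> x \<in> U \<Longrightarrow> (f has_derivative fderiv f x) (at x)"
  by (simp add: frechet_derivative_works)

lemma Ck_on_const: "open U \<Longrightarrow> Ck_on k U (\<lambda>x. c)"
proof (induction k arbitrary: c)
  case (Suc k)
  then show ?case by (intro Ck_on_SucI'[where f' = "\<lambda>x v. 0"]) auto
qed auto

lemma Ck_on_linear:
  assumes "open U" "bounded_linear f"
  shows "Ck_on k U f"
proof (cases k)
  case 0
  then show ?thesis by (simp add: assms linear_continuous_on)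
next
  case (Suc j)
  show ?thesis
    unfolding Suc
    by (rule Ck_on_SucI'[OF assms(1) bounded_linear_imp_has_derivative[OF assms(2)] Ck_on_const[OF assms(1)]])
qed

lemma Ck_on_add:
  assumes U: "open U"
  shows "Ck_on k U f \<Longrightarrow> Ck_on k U g \<Longrightarrow> Ck_on k U (\<lambda>x. f x + g x)"
proof (induction k arbitrary: f g)
  case 0
  then show ?case by (auto intro: continuous_intros)
next
  case (Suc k)
  show ?case
  proof (rule Ck_on_SucI'[OF U])
    show "((\<lambda>x. f x + g x) has_derivative (\<lambda>v. fderiv f x v + fderiv g x v)) (at x)"
      if "x \<in> U" for x
      using Suc.prems that by (intro has_derivative_add Ck_on_has_derivative)
    show "Ck_on k U (\<lambda>x. fderiv f x v + fderiv g x v)" for v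
      using Suc.prems by (intro Suc.IH) auto
  qed
qed

text \<open>The product rule yields two terms of the same form, which closes the induction. Scaling,
  multiplication and the inner product are instances.\<close>

lemma Ck_on_bilinear:
  assumes U: "open U" and b: "bounded_bilinear p"
  shows "Ck_on k U f \<Longrightarrow> Ck_on k U g \<Longrightarrow> Ck_on k U (\<lambda>x. p (f x) (g x))"
proof (induction k arbitrary: f g)
  case 0
  then show ?case by (auto intro: bounded_bilinear.continuous_on[OF b])
next
  case (Suc k)
  show ?case
  proof (rule Ck_on_SucI'[OF U])
    show "((\<lambda>x. p (f x) (g x)) has_derivative (\<lambda>v. p (f x) (fderiv g x v) + p (fderiv f x v) (g x))) (at x)"
      if "x \<in> U" for x
      using Suc.prems that by (intro bounded_bilinear.FDERIV[OF b] Ck_on_has_derivative)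
    show "Ck_on k U (\<lambda>x. p (f x) (fderiv g x v) + p (fderiv f x v) (g x))" for v
      by (intro Ck_on_add[OF U] Suc.IH)
        (use Suc.prems Ck_on_SucD[OF Suc.prems(1)] Ck_on_SucD[OF Suc.prems(2)] in simp_all)
  qed
qed

lemma Ck_on_sum:
  assumes U: "open U"
  shows "(\<And>i. i \<in> I \<Longrightarrow> Ck_on k U (f i)) \<Longrightarrow> Ck_on k U (\<lambda>x. \<Sum>i\<in>I. f i x)"
  by (induction I rule: infinite_finite_induct) (auto intro: Ck_on_add Ck_on_const U)

lemma linear_apply_Basis:
  fixes A :: "'a::euclidean_space \<Rightarrow> 'b::real_vector"
  assumes "linear A"
  shows "A v = (\<Sum>b\<in>Basis. (v \<bullet> b) *\<^sub>R A b)"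
proof -
  have "A v = A (\<Sum>b\<in>Basis. (v \<bullet> b) *\<^sub>R b)"
    by (simp only: euclidean_representation)
  also have "\<dots> = (\<Sum>b\<in>Basis. A ((v \<bullet> b) *\<^sub>R b))"
    by (rule linear_sum[OF assms])
  also have "\<dots> = (\<Sum>b\<in>Basis. (v \<bullet> b) *\<^sub>R A b)"
    by (simp only: linear_cmul[OF assms])
  finally show ?thesis .
qed

text \<open>\<open>Ck_on\<close> controls derivatives in fixed directions, while the chain rule
  produces varying ones. Expanding \<open>w x\<close> in the basis reduces the latter to finitely
  many products.\<close>

lemma Ck_on_apply_linear:
  fixes A :: "'a::real_normed_vector \<Rightarrow> 'b::euclidean_space \<Rightarrow> 'c::real_normed_vector"
  assumes U: "open U" and lin: "\<And>x. x \<in> U \<Longrightarrow> linear (A x)"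
    and A: "\<And>v. Ck_on k U (\<lambda>x. A x v)" and w: "Ck_on k U w"
  shows "Ck_on k U (\<lambda>x. A x (w x))"
proof (rule Ck_on_cong[OF U])
  show "(\<Sum>b\<in>Basis. (w x \<bullet> b) *\<^sub>R A x b) = A x (w x)" if "x \<in> U" for x
    by (rule linear_apply_Basis[OF lin[OF that], symmetric])
  have "Ck_on k U (\<lambda>x. w x \<bullet> b)" for b
    by (rule Ck_on_bilinear[OF U bounded_bilinear_inner w Ck_on_const[OF U]])
  then show "Ck_on k U (\<lambda>x. \<Sum>b\<in>Basis. (w x \<bullet> b) *\<^sub>R A x b)"
    by (intro Ck_on_sum[OF U] Ck_on_bilinear[OF U bounded_bilinear_scaleR] A)
qed

lemma Ck_on_compose:
  fixes f :: "'b::euclidean_space \<Rightarrow> 'c::real_normed_vector"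
  assumes U: "open U" and gUV: "g ` U \<subseteq> V"
  shows "Ck_on k V f \<Longrightarrow> Ck_on k U g \<Longrightarrow> Ck_on k U (\<lambda>x. f (g x))"
  using gUV
proof (induction k arbitrary: f g)
  case 0
  then show ?case by (auto intro: continuous_on_compose2)
next
  case (Suc k)
  show ?case
  proof (rule Ck_on_SucI'[OF U])
    show "((\<lambda>x. f (g x)) has_derivative (\<lambda>v. fderiv f (g x) (fderiv g x v))) (at x)"
      if "x \<in> U" for x
      using diff_chain_at[OF Ck_on_has_derivative Ck_on_has_derivative] Suc.prems that
      unfolding o_def by blast
    show "Ck_on k U (\<lambda>x. fderiv f (g x) (fderiv g x v))" for v
    proof (rule Ck_on_apply_linear[OF U])
      show "linear (fderiv f (g x))" if "x \<in> U" for x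
        using Suc.prems that by (auto intro: linear_frechet_derivative)
      show "Ck_on k U (\<lambda>x. fderiv f (g x) v)" for v
        by (rule Suc.IH) (use Suc.prems Ck_on_SucD[OF Suc.prems(2)] in simp_all)
    qed (use Suc.prems in auto)
  qed
qed

lemma Ck_on_Pair:
  assumes U: "open U" and f: "Ck_on k U f" and g: "Ck_on k U g"
  shows "Ck_on k U (\<lambda>x. (f x, g x))"
proof -
  have *: "Ck_on k U (\<lambda>x. L (h x))" if "Ck_on k U h" "bounded_linear L" for h and L :: "'y::real_normed_vector \<Rightarrow> 'z::real_normed_vector"
    using that
  proof (induction k arbitrary: h)
    case 0
    then show ?case by (auto intro: bounded_linear.continuous_on)
  next
    case (Suc k)
    then show ?case
      by (intro Ck_on_SucI'[OF U bounded_linear.has_derivative[OF _ Ck_on_has_derivative]]) auto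
  qed
  show ?thesis
    using Ck_on_add[OF U *[OF f, of "\<lambda>y. (y, 0)"] *[OF g, of "\<lambda>y. (0, y)"]]
    by (simp add: bounded_linear_Pair bounded_linear_ident bounded_linear_zero)
qed

text \<open>The derivative of a power is a multiple of another power, so the induction on
  \<open>k\<close> runs over all exponents at once.\<close>

lemma Ck_on_powr:
  assumes U: "open U" and f: "Ck_on k U f" "\<And>x. x \<in> U \<Longrightarrow> 0 < (f x :: real)"
  shows "Ck_on k U (\<lambda>x. f x powr a)"
proof (rule Ck_on_compose[OF U, where f = "\<lambda>r. r powr a" and g = f and V = "{0<..}"])
  show "Ck_on k {0<..} (\<lambda>r::real. r powr a)"
  proof (induction k arbitrary: a)
    case 0
    then show ?case by (auto intro!: continuous_intros)
  next
    case (Suc k)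
    show ?case
    proof (rule Ck_on_SucI'[where f' = "\<lambda>x v. (v * a) * x powr (a - 1)"])
      show "((\<lambda>r. r powr a) has_derivative (\<lambda>v. (v * a) * x powr (a - 1))) (at x)" if "x \<in> {0<..}" for x
      proof -
        have "(*) (a * x powr (a - 1)) = (\<lambda>v. (v * a) * x powr (a - 1))"
          by (simp add: fun_eq_iff)
        then show ?thesis
          using has_real_derivative_powr[of x a] that
          by (metis greaterThan_iff has_field_derivative_def)
      qed
      show "Ck_on k {0<..} (\<lambda>r. (v * a) * r powr (a - 1))" for v
        by (rule Ck_on_bilinear[OF _ bounded_bilinear_mult Ck_on_const Suc.IH]) auto
    qed auto
  qed
qed (use f in auto)

section \<open>Solving smooth families of linear equations\<close>

text \<open>Where the scalar factor vanishes, mere continuity of the other factor suffices: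
  \<open>\<phi> y\<close> is of order \<open>norm (y - x)\<close>, so replacing \<open>c y\<close>
  by \<open>c x\<close> changes the product only to smaller order.\<close>

lemma has_derivative_scaleR_vanishing:
  fixes \<phi> :: "'a::real_normed_vector \<Rightarrow> real" and c :: "'a \<Rightarrow> 'b::real_normed_vector"
  assumes der: "(\<phi> has_derivative \<phi>') (at x)" and 0: "\<phi> x = 0" and c: "isCont c x"
  shows "((\<lambda>y. \<phi> y *\<^sub>R c y) has_derivative (\<lambda>h. \<phi>' h *\<^sub>R c x)) (at x)"
  unfolding has_derivative_at_alt
proof (intro conjI allI impI)
  have bl: "bounded_linear \<phi>'"
    using der by (rule has_derivative_bounded_linear)
  then show "bounded_linear (\<lambda>h. \<phi>' h *\<^sub>R c x)"
    by (rule bounded_linear_scaleR_const)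
  obtain K where K: "0 < K" "\<And>h. norm (\<phi>' h) \<le> norm h * K"
    using bounded_linear.pos_bounded[OF bl] by blast
  have alt: "\<exists>d>0. \<forall>y. norm (y - x) < d \<longrightarrow> norm (\<phi> y - \<phi>' (y - x)) \<le> e * norm (y - x)" if "e > 0" for e
    using der that unfolding has_derivative_at_alt by (simp add: 0)
  fix e :: real assume "0 < e"
  \<comment> \<open>\<open>e1\<close> bounds \<open>c y - c x\<close> against
    \<open>norm (\<phi> y) \<le> norm (y - x) * (1 + K)\<close>, and \<open>e2\<close> bounds the
    linearisation error against \<open>norm (c x)\<close>; each error term receives half of
    \<open>e\<close>. The \<open>1 +\<close> in \<open>e2\<close> keeps the denominator
    positive.\<close>
  define e1 where "e1 = e / (2 * (1 + K))"
  define e2 where "e2 = e / (2 * (1 + norm (c x)))"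
  have e12: "0 < e1" "0 < e2" "e1 * (1 + K) = e / 2" "e2 * norm (c x) \<le> e / 2"
    using \<open>0 < e\<close> K by (auto simp: e1_def e2_def field_simps add_pos_nonneg)
  obtain d1 where d1: "d1 > 0" "\<And>y. norm (y - x) < d1 \<Longrightarrow> norm (\<phi> y - \<phi>' (y - x)) \<le> 1 * norm (y - x)"
    using alt[of 1] by auto
  obtain d2 where d2: "d2 > 0" "\<And>y. norm (y - x) < d2 \<Longrightarrow> norm (\<phi> y - \<phi>' (y - x)) \<le> e2 * norm (y - x)"
    using alt[OF e12(2)] by auto
  obtain d3 where d3: "d3 > 0" "\<And>y. norm (y - x) < d3 \<Longrightarrow> norm (c y - c x) \<le> e1"
    using c e12(1) unfolding isCont_def LIM_eq by (metis less_eq_real_def norm_zero right_minus_eq)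
  show "\<exists>d>0. \<forall>y. norm (y - x) < d \<longrightarrow>
      norm (\<phi> y *\<^sub>R c y - \<phi> x *\<^sub>R c x - \<phi>' (y - x) *\<^sub>R c x) \<le> e * norm (y - x)"
  proof (intro exI[of _ "min d1 (min d2 d3)"] conjI allI impI)
    fix y assume y: "norm (y - x) < min d1 (min d2 d3)"
    have "norm (\<phi> y) \<le> norm (\<phi> y - \<phi>' (y - x)) + norm (\<phi>' (y - x))"
      using norm_triangle_sub[of "\<phi> y" "\<phi>' (y - x)"] by simp
    also have "\<dots> \<le> norm (y - x) * (1 + K)"
      using d1(2)[of y] K(2)[of "y - x"] y by (simp add: algebra_simps)
    finally have "norm (\<phi> y) * norm (c y - c x) \<le> (norm (y - x) * (1 + K)) * e1"
      using d3(2)[of y] y e12 K by (intro mult_mono) auto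
    also have "\<dots> = e / 2 * norm (y - x)"
      using e12(3) by (metis mult.assoc mult.commute)
    finally have 1: "norm (\<phi> y *\<^sub>R (c y - c x)) \<le> e / 2 * norm (y - x)"
      by simp
    have "norm (\<phi> y - \<phi>' (y - x)) * norm (c x) \<le> (e2 * norm (y - x)) * norm (c x)"
      using d2(2)[of y] y by (intro mult_right_mono) auto
    also have "\<dots> \<le> e / 2 * norm (y - x)"
      using mult_right_mono[OF e12(4), of "norm (y - x)"] by (simp add: algebra_simps)
    finally have 2: "norm ((\<phi> y - \<phi>' (y - x)) *\<^sub>R c x) \<le> e / 2 * norm (y - x)"
      by simp
    have "\<phi> y *\<^sub>R c y - \<phi> x *\<^sub>R c x - \<phi>' (y - x) *\<^sub>R c x
        = \<phi> y *\<^sub>R (c y - c x) + (\<phi> y - \<phi>' (y - x)) *\<^sub>R c x"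
      unfolding 0 by (simp add: algebra_simps)
    then show "norm (\<phi> y *\<^sub>R c y - \<phi> x *\<^sub>R c x - \<phi>' (y - x) *\<^sub>R c x) \<le> e * norm (y - x)"
      using norm_triangle_mono[OF 1 2] by simp
  qed (use d1 d2 d3 in auto)
qed

text \<open>A lower bound \<open>c\<close> for the injective map at \<open>x\<^sub>0\<close>
  survives, halved, a perturbation of size \<open>c / 2\<close>. This serves both for continuity of
  solutions and for injectivity on a neighbourhood.\<close>

lemma linear_family_bounded_below:
  fixes A :: "'x::real_normed_vector \<Rightarrow> 'a::euclidean_space \<Rightarrow> 'b::euclidean_space"
  assumes U: "open U" "x\<^sub>0 \<in> U" and lin: "\<And>x. x \<in> U \<Longrightarrow> linear (A x)" and inj: "inj (A x\<^sub>0)"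
    and cont: "\<And>v. continuous_on U (\<lambda>x. A x v)"
  shows "\<exists>C>0. \<forall>\<^sub>F x in nhds x\<^sub>0. x \<in> U \<and> (\<forall>u. norm u \<le> C * norm (A x u))"
proof -
  have bl: "bounded_linear (A x\<^sub>0)"
    using lin U linear_conv_bounded_linear by blast
  obtain c where c: "c > 0" "\<And>u. c * norm u \<le> norm (A x\<^sub>0 u)"
    using linear_inj_bounded_below_pos[OF lin[OF U(2)] inj] by metis
  \<comment> \<open>This sum over the basis bounds the operator norm of
    \<open>A x\<^sub>0 - A x\<close> and tends to zero because every component is
    continuous.\<close>
  define \<eta> where "\<eta> = (\<lambda>x. \<Sum>b\<in>Basis. norm (A x\<^sub>0 b - A x b))"
  have "(\<eta> \<longlongrightarrow> (\<Sum>b\<in>Basis. norm (A x\<^sub>0 b - A x\<^sub>0 b))) (nhds x\<^sub>0)"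
    unfolding \<eta>_def
    using cont U by (intro tendsto_sum tendsto_norm tendsto_diff tendsto_const)
      (metis continuous_on_eq_continuous_at continuous_at tendsto_at_iff_tendsto_nhds)
  then have "\<forall>\<^sub>F x in nhds x\<^sub>0. \<eta> x < c / 2"
    by (rule order_tendstoD) (use c(1) in simp)
  moreover have "\<forall>\<^sub>F x in nhds x\<^sub>0. x \<in> U"
    using U by (rule eventually_nhds_in_open)
  ultimately have "\<forall>\<^sub>F x in nhds x\<^sub>0. x \<in> U \<and> (\<forall>u. norm u \<le> 2 / c * norm (A x u))"
  proof eventually_elim
    case (elim x)
    have "norm u \<le> 2 / c * norm (A x u)" for u
    proof -
      have "A x\<^sub>0 u - A x u = (\<Sum>b\<in>Basis. (u \<bullet> b) *\<^sub>R (A x\<^sub>0 b - A x b))"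
        using linear_apply_Basis[OF lin[OF elim(2)], of u] linear_apply_Basis[OF lin[OF U(2)], of u]
        by (simp add: scaleR_right_diff_distrib sum_subtractf)
      also have "norm \<dots> \<le> (\<Sum>b\<in>Basis. norm u * norm (A x\<^sub>0 b - A x b))"
        by (intro order_trans[OF norm_sum] sum_mono) (auto intro!: mult_right_mono Basis_le_norm)
      also have "\<dots> = norm u * \<eta> x"
        by (simp add: \<eta>_def sum_distrib_left)
      also have "\<dots> \<le> norm u * (c / 2)"
        using elim by (intro mult_left_mono) auto
      finally have "norm (A x\<^sub>0 u) \<le> norm (A x u) + c / 2 * norm u"
        using norm_triangle_ineq2[of "A x\<^sub>0 u" "A x u"] by (simp add: mult.commute)
      then have "c / 2 * norm u \<le> norm (A x u)"
        using c(2)[of u] by (simp add: field_simps)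
      then show ?thesis
        using c(1) by (simp add: field_simps)
    qed
    then show ?case using elim by blast
  qed
  then show ?thesis
    using c(1) by (intro exI[of _ "2 / c"]) auto
qed

text \<open>The identity \<open>A x (w x - w x\<^sub>0) = v x - A x (w x\<^sub>0)\<close> has a
  right-hand side tending to zero, and the uniform lower bound transfers this to
  \<open>w\<close>.\<close>

lemma continuous_on_linear_solve:
  fixes A :: "'x::real_normed_vector \<Rightarrow> 'a::euclidean_space \<Rightarrow> 'b::euclidean_space"
  assumes U: "open U" and lin: "\<And>x. x \<in> U \<Longrightarrow> linear (A x)" and inj: "\<And>x. x \<in> U \<Longrightarrow> inj (A x)"
    and A: "\<And>v. continuous_on U (\<lambda>x. A x v)" and v: "continuous_on U v"
    and w: "\<And>x. x \<in> U \<Longrightarrow> A x (w x) = v x"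
  shows "continuous_on U w"
proof (intro continuous_at_imp_continuous_on ballI)
  fix x\<^sub>0 assume x0: "x\<^sub>0 \<in> U"
  obtain C where "C > 0" and C: "\<forall>\<^sub>F x in nhds x\<^sub>0. x \<in> U \<and> (\<forall>u. norm u \<le> C * norm (A x u))"
    using linear_family_bounded_below[OF U x0 lin inj[OF x0] A] by blast
  have "\<forall>\<^sub>F x in at x\<^sub>0. x \<in> U \<and> (\<forall>u. norm u \<le> C * norm (A x u))"
    using C eventually_nhds_conv_at by blast
  then have "\<forall>\<^sub>F x in at x\<^sub>0. norm (w x - w x\<^sub>0) \<le> C * norm (v x - A x (w x\<^sub>0))"
  proof eventually_elim
    case (elim x)
    then show ?case
      using w[of x] linear_diff[OF lin, of x "w x" "w x\<^sub>0"] by metis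
  qed
  moreover have "isCont v x\<^sub>0" "isCont (\<lambda>x. A x (w x\<^sub>0)) x\<^sub>0"
    using U A v x0 by (simp_all add: continuous_on_eq_continuous_at)
  then have "((\<lambda>x. C * norm (v x - A x (w x\<^sub>0))) \<longlongrightarrow> C * norm (v x\<^sub>0 - A x\<^sub>0 (w x\<^sub>0))) (at x\<^sub>0)"
    unfolding isCont_def by (intro tendsto_intros)
  then have "((\<lambda>x. C * norm (v x - A x (w x\<^sub>0))) \<longlongrightarrow> 0) (at x\<^sub>0)"
    using w[OF x0] by simp
  ultimately have "((\<lambda>x. w x - w x\<^sub>0) \<longlongrightarrow> 0) (at x\<^sub>0)"
    by (rule Lim_null_comparison)
  then show "isCont w x\<^sub>0"
    unfolding isCont_def using LIM_zero_cancel by blast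
qed

text \<open>The induction differentiates \<open>A x (w x) = v x\<close>: the directional derivative \<open>w'\<close> of \<open>w\<close> solves
  \<open>A w' = v' - A' w\<close>, a system of the same form with a right-hand side of one class less.\<close>

lemma Ck_on_linear_solve:
  fixes A :: "'x::real_normed_vector \<Rightarrow> 'a::euclidean_space \<Rightarrow> 'a" and v w :: "'x \<Rightarrow> 'a"
  assumes U: "open U" and lin: "\<And>x. x \<in> U \<Longrightarrow> linear (A x)" and inj: "\<And>x. x \<in> U \<Longrightarrow> inj (A x)"
  shows "(\<And>u. Ck_on k U (\<lambda>x. A x u)) \<Longrightarrow> Ck_on k U v \<Longrightarrow> (\<And>x. x \<in> U \<Longrightarrow> A x (w x) = v x) \<Longrightarrow> Ck_on k U w"
proof (induction k arbitrary: v w)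
  case 0
  then show ?case
    using continuous_on_linear_solve[OF U lin inj, where v = v and w = w] by simp
next
  case (Suc k)
  have surj: "\<exists>u. A x u = z" if "x \<in> U" for x z
    using linear_injective_imp_surjective[OF lin inj] that by (metis surjD)
  \<comment> \<open>The columns of the inverse of \<open>A x\<close>. Only their continuity is
    available when \<open>w\<close> is to be differentiated.\<close>
  define c where "c = (\<lambda>b x. SOME u. A x u = b)"
  have c: "A x (c b x) = b" if "x \<in> U" for x b
    unfolding c_def by (rule someI_ex[OF surj[OF that]])
  have A0: "continuous_on U (\<lambda>x. A x u)" for u
    using Suc.prems(1)[of u] U by (intro continuous_at_imp_continuous_on) (auto intro: differentiable_imp_continuous_within)
  have contc: "continuous_on U (c b)" for b
    by (rule continuous_on_linear_solve[OF U lin inj A0 continuous_on_const c])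
  \<comment> \<open>\<open>w x\<close> is frozen at the base point while \<open>A\<close> is
    differentiated, so no derivative of \<open>w\<close> is presupposed.\<close>
  define R where "R = (\<lambda>x h. fderiv v x h - fderiv (\<lambda>y. A y (w x)) x h)"
  define w' where "w' = (\<lambda>x h. \<Sum>b\<in>Basis. (R x h \<bullet> b) *\<^sub>R c b x)"
  have Aw': "A x (w' x h) = R x h" if "x \<in> U" for x h
    using that by (simp add: w'_def linear_sum[OF lin] linear_cmul[OF lin] c euclidean_representation)
  have der: "(w has_derivative w' x) (at x)" if x: "x \<in> U" for x
  proof -
    \<comment> \<open>\<open>w y\<close> equals \<open>w x\<close> plus the inverse of
      \<open>A y\<close> applied to \<open>r y\<close>. Since \<open>r x = 0\<close>, continuity of
      the columns \<open>c b\<close> is enough to differentiate.\<close>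
    define r where "r = (\<lambda>y. v y - A y (w x))"
    have r': "(r has_derivative R x) (at x)"
      unfolding r_def R_def
      by (intro has_derivative_diff Ck_on_has_derivative[OF Suc.prems(2) x] Ck_on_has_derivative[OF Suc.prems(1) x])
    have "((\<lambda>y. w x + (\<Sum>b\<in>Basis. (r y \<bullet> b) *\<^sub>R c b y)) has_derivative (\<lambda>h. 0 + w' x h)) (at x)"
      unfolding w'_def
    proof (intro has_derivative_add has_derivative_const has_derivative_sum has_derivative_scaleR_vanishing)
      show "((\<lambda>y. r y \<bullet> b) has_derivative (\<lambda>h. R x h \<bullet> b)) (at x)" for b
        by (intro has_derivative_inner_left r')
      show "r x \<bullet> b = 0" for b using Suc.prems(3)[OF x] by (simp add: r_def)
      show "isCont (c b) x" for b
        using contc U x by (simp add: continuous_on_eq_continuous_at)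
    qed
    then have "((\<lambda>y. w x + (\<Sum>b\<in>Basis. (r y \<bullet> b) *\<^sub>R c b y)) has_derivative w' x) (at x)"
      by simp
    then show ?thesis
    proof (rule has_derivative_transform_within_open[OF _ U x])
      fix y assume y: "y \<in> U"
      have "A y (w x + (\<Sum>b\<in>Basis. (r y \<bullet> b) *\<^sub>R c b y)) = A y (w y)"
        using y Suc.prems(3)[OF y]
        by (simp add: linear_add[OF lin] linear_sum[OF lin] linear_cmul[OF lin] c euclidean_representation r_def)
      then show "w x + (\<Sum>b\<in>Basis. (r y \<bullet> b) *\<^sub>R c b y) = w y"
        using inj[OF y] by (simp add: inj_eq)
    qed
  qed
  \<comment> \<open>\<open>R\<close> contains \<open>w\<close> itself, so class \<open>k\<close> for
    \<open>w\<close> has to precede class \<open>k\<close> for its derivative.\<close>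
  have wk: "Ck_on k U w"
    by (rule Suc.IH[OF _ _ Suc.prems(3)]) (use Suc.prems Ck_on_SucD in blast)+
  show ?case
  proof (rule Ck_on_SucI'[OF U der])
    fix h
    have "Ck_on k U (\<lambda>x. fderiv (\<lambda>y. A y (w x)) x h)"
    proof (rule Ck_on_apply_linear[OF U, where A = "\<lambda>x u. fderiv (\<lambda>y. A y u) x h"])
      fix x assume x: "x \<in> U"
      have d: "((\<lambda>y. A y u) has_derivative fderiv (\<lambda>y. A y u) x) (at x)" for u
        by (rule Ck_on_has_derivative[OF Suc.prems(1) x])
      show "linear (\<lambda>u. fderiv (\<lambda>y. A y u) x h)"
      proof (rule linearI)
        fix u1 u2
        have "((\<lambda>y. A y (u1 + u2)) has_derivative (\<lambda>h. fderiv (\<lambda>y. A y u1) x h + fderiv (\<lambda>y. A y u2) x h)) (at x)"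
          by (rule has_derivative_transform_within_open[OF has_derivative_add[OF d d] U x])
            (simp add: linear_add[OF lin])
        from fderiv_eqI[OF this]
        show "fderiv (\<lambda>y. A y (u1 + u2)) x h = fderiv (\<lambda>y. A y u1) x h + fderiv (\<lambda>y. A y u2) x h"
          by simp
      next
        fix r u
        have "((\<lambda>y. A y (r *\<^sub>R u)) has_derivative (\<lambda>h. r *\<^sub>R fderiv (\<lambda>y. A y u) x h)) (at x)"
          by (rule has_derivative_transform_within_open[OF has_derivative_scaleR_right[OF d] U x])
            (simp add: linear_cmul[OF lin])
        from fderiv_eqI[OF this]
        show "fderiv (\<lambda>y. A y (r *\<^sub>R u)) x h = r *\<^sub>R fderiv (\<lambda>y. A y u) x h"
          by simp
      qed
    qed (use Suc.prems wk in auto)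
    then have "Ck_on k U (\<lambda>x. fderiv v x h + (-1) *\<^sub>R fderiv (\<lambda>y. A y (w x)) x h)"
      using Suc.prems by (intro Ck_on_add[OF U] Ck_on_bilinear[OF U bounded_bilinear_scaleR] Ck_on_const[OF U]) auto
    then have R: "Ck_on k U (\<lambda>x. R x h)"
      by (simp add: R_def)
    show "Ck_on k U (\<lambda>x. w' x h)"
      by (rule Suc.IH[OF Ck_on_SucD[OF Suc.prems(1)] R Aw'])
  qed
qed

section \<open>Inverse and implicit functions\<close>

lemma smooth_onD: "smooth_on U f \<Longrightarrow> Ck_on k U f"
  by (simp add: smooth_on_def)

lemma smooth_on_has_derivative:
  "smooth_on U f \<Longrightarrow> x \<in> U \<Longrightarrow> (f has_derivative fderiv f x) (at x)"
  using smooth_onD Ck_on_has_derivative by blast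

lemma smooth_on_linear_fderiv: "smooth_on U f \<Longrightarrow> x \<in> U \<Longrightarrow> linear (fderiv f x)"
  using smooth_on_has_derivative has_derivative_linear by blast

lemma smooth_on_continuous_on: "smooth_on U f \<Longrightarrow> continuous_on U f"
  using smooth_onD[of U f 0] by simp

lemma smooth_on_subset: "smooth_on U f \<Longrightarrow> V \<subseteq> U \<Longrightarrow> smooth_on V f"
  unfolding smooth_on_def using Ck_on_subset by blast

lemma smooth_on_fderiv: "smooth_on U f \<Longrightarrow> smooth_on U (\<lambda>x. fderiv f x v)"
  unfolding smooth_on_def by (metis Ck_on.simps(2))

lemma smooth_on_const: "open U \<Longrightarrow> smooth_on U (\<lambda>x. c)"
  by (simp add: smooth_on_def Ck_on_const)

lemma smooth_on_linear: "open U \<Longrightarrow> bounded_linear f \<Longrightarrow> smooth_on U f"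
  by (simp add: smooth_on_def Ck_on_linear)

lemma smooth_on_bilinear:
  "bounded_bilinear p \<Longrightarrow> open U \<Longrightarrow> smooth_on U f \<Longrightarrow> smooth_on U g \<Longrightarrow> smooth_on U (\<lambda>x. p (f x) (g x))"
  by (simp add: smooth_on_def Ck_on_bilinear)

lemmas smooth_on_inner = smooth_on_bilinear[OF bounded_bilinear_inner]
lemmas smooth_on_scaleR = smooth_on_bilinear[OF bounded_bilinear_scaleR]

lemma smooth_on_add: "open U \<Longrightarrow> smooth_on U f \<Longrightarrow> smooth_on U g \<Longrightarrow> smooth_on U (\<lambda>x. f x + g x)"
  by (simp add: smooth_on_def Ck_on_add)

lemma smooth_on_diff: "open U \<Longrightarrow> smooth_on U f \<Longrightarrow> smooth_on U g \<Longrightarrow> smooth_on U (\<lambda>x. f x - g x)"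
  using smooth_on_add[of U f "\<lambda>x. (-1) *\<^sub>R g x"] smooth_on_scaleR[of U "\<lambda>x. -1" g] smooth_on_const
  by auto

lemma smooth_on_sum:
  "open U \<Longrightarrow> (\<And>i. i \<in> I \<Longrightarrow> smooth_on U (f i)) \<Longrightarrow> smooth_on U (\<lambda>x. \<Sum>i\<in>I. f i x)"
  by (simp add: smooth_on_def Ck_on_sum)

lemma smooth_on_compose:
  fixes f :: "'b::euclidean_space \<Rightarrow> 'c::real_normed_vector"
  assumes "open U" "smooth_on V f" "smooth_on U g" "\<And>x. x \<in> U \<Longrightarrow> g x \<in> V"
  shows "smooth_on U (\<lambda>x. f (g x))"
  unfolding smooth_on_def
proof
  fix k
  show "Ck_on k U (\<lambda>x. f (g x))"
    using assms(4) by (intro Ck_on_compose[OF assms(1) _ smooth_onD[OF assms(2)] smooth_onD[OF assms(3)]]) blast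
qed

lemma smooth_on_compose_linear:
  fixes f :: "'b::euclidean_space \<Rightarrow> 'c::real_normed_vector"
  shows "open U \<Longrightarrow> bounded_linear f \<Longrightarrow> smooth_on U g \<Longrightarrow> smooth_on U (\<lambda>x. f (g x))"
  by (rule smooth_on_compose[OF _ smooth_on_linear[OF open_UNIV]]) auto

lemma smooth_on_fderiv_apply:
  fixes f :: "'b::euclidean_space \<Rightarrow> 'c::real_normed_vector"
  assumes "open U" "smooth_on V f" "smooth_on U g" "\<And>x. x \<in> U \<Longrightarrow> g x \<in> V" "smooth_on U w"
  shows "smooth_on U (\<lambda>x. fderiv f (g x) (w x))"
  unfolding smooth_on_def
proof
  fix k
  have "smooth_on U (\<lambda>x. fderiv f (g x) v)" for v
    by (rule smooth_on_compose[OF assms(1) smooth_on_fderiv[OF assms(2)] assms(3,4)])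
  then show "Ck_on k U (\<lambda>x. fderiv f (g x) (w x))"
    using Ck_on_apply_linear[OF assms(1) smooth_on_linear_fderiv[OF assms(2) assms(4)] smooth_onD smooth_onD[OF assms(5)]]
    by simp
qed

lemma smooth_on_Pair: "open U \<Longrightarrow> smooth_on U f \<Longrightarrow> smooth_on U g \<Longrightarrow> smooth_on U (\<lambda>x. (f x, g x))"
  by (simp add: smooth_on_def Ck_on_Pair)

lemma smooth_on_powr:
  "open U \<Longrightarrow> smooth_on U f \<Longrightarrow> (\<And>x. x \<in> U \<Longrightarrow> 0 < (f x :: real)) \<Longrightarrow> smooth_on U (\<lambda>x. f x powr a)"
  by (simp add: smooth_on_def Ck_on_powr)

text \<open>\<open>g' y v\<close> solves the linear system with matrix \<open>fderiv f (g y)\<close>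
  and constant right-hand side \<open>v\<close>. If \<open>g\<close> is of class \<open>k\<close>,
  so are the coefficients, hence also the solution, and \<open>g\<close> gains one class.\<close>

lemma smooth_inverse_function_theorem:
  fixes f :: "'a::euclidean_space \<Rightarrow> 'a"
  assumes W: "open W" "x\<^sub>0 \<in> W" and f: "smooth_on W f" and inj: "inj (fderiv f x\<^sub>0)"
  obtains U V g where "open U" "x\<^sub>0 \<in> U" "U \<subseteq> W" "open V" "homeomorphism U V f g" "smooth_on V g"
    "\<And>x. x \<in> U \<Longrightarrow> inj (fderiv f x)"
proof -
  define f' where "f' = (\<lambda>x. Blinfun (fderiv f x))"
  have der: "(f has_derivative fderiv f x) (at x)" if "x \<in> W" for x
    using smooth_on_has_derivative[OF f that] .
  have f': "blinfun_apply (f' x) = fderiv f x" if "x \<in> W" for x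
    unfolding f'_def using has_derivative_bounded_linear[OF der[OF that]]
    by (rule bounded_linear_Blinfun_apply)
  \<comment> \<open>Continuity in operator norm follows, in finite dimension, from continuity of
    each directional derivative.\<close>
  have cont: "continuous_on W f'"
  proof (rule continuous_on_blinfun_componentwise)
    fix i :: 'a
    have "continuous_on W (\<lambda>x. fderiv f x i)"
      by (rule smooth_on_continuous_on[OF smooth_on_fderiv[OF f]])
    then show "continuous_on W (\<lambda>x. blinfun_apply (f' x) i)"
      by (simp add: f' cong: continuous_on_cong_simp)
  qed
  obtain h where h: "linear h" "h \<circ> fderiv f x\<^sub>0 = id"
    using linear_injective_left_inverse[OF smooth_on_linear_fderiv[OF f W(2)] inj] by blast
  have bh: "blinfun_apply (Blinfun h) = h"
    using h(1) linear_conv_bounded_linear bounded_linear_Blinfun_apply by blast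
  have "Blinfun h o\<^sub>L f' x\<^sub>0 = id_blinfun"
    by (rule blinfun_eqI) (use h(2) in \<open>simp add: bh f'[OF W(2)] fun_eq_iff\<close>)
  then obtain U V g g' where U: "open U" "U \<subseteq> W" "x\<^sub>0 \<in> U" and V: "open V" and hom: "homeomorphism U V f g"
    and g': "\<And>y. y \<in> V \<Longrightarrow> (g has_derivative (g' y)) (at y)"
      "\<And>y. y \<in> V \<Longrightarrow> g' y = inv (blinfun_apply (f' (g y)))"
      "\<And>y. y \<in> V \<Longrightarrow> bij (blinfun_apply (f' (g y)))"
    using inverse_function_theorem[of W f f' x\<^sub>0 "Blinfun h"] W cont der f' by metis
  have gU: "g y \<in> U" if "y \<in> V" for y
    using hom that by (auto simp: homeomorphism_def)
  have bij: "bij (fderiv f (g y))" if "y \<in> V" for y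
    using g'(3)[OF that] f' gU[OF that] U(2) by (metis subsetD)
  have "Ck_on k V g" for k
  proof (induction k)
    case 0
    then show ?case using hom by (simp add: homeomorphism_def)
  next
    case (Suc k)
    show ?case
    proof (rule Ck_on_SucI'[OF V g'(1)])
      fix v
      show "Ck_on k V (\<lambda>y. g' y v)"
      proof (rule Ck_on_linear_solve[OF V, where A = "\<lambda>y. fderiv f (g y)"])
        show "linear (fderiv f (g y))" if "y \<in> V" for y
          using smooth_on_linear_fderiv[OF f] gU[OF that] U(2) by blast
        show "inj (fderiv f (g y))" if "y \<in> V" for y
          using bij[OF that] by (rule bij_is_inj)
        show "Ck_on k V (\<lambda>y. fderiv f (g y) u)" for u
          using Ck_on_compose[OF V _ smooth_onD[OF smooth_on_fderiv[OF f]] Suc] gU U(2) by blast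
        show "fderiv f (g y) (g' y v) = v" if "y \<in> V" for y
          using bij[OF that] g'(2)[OF that] f' gU[OF that] U(2)
          by (metis bij_inv_eq_iff subsetD)
      qed (rule Ck_on_const[OF V])
    qed
  qed
  then have "smooth_on V g"
    by (simp add: smooth_on_def)
  moreover have "inj (fderiv f x)" if "x \<in> U" for x
    using bij[of "f x"] that hom by (metis bij_is_inj homeomorphism_def imageI)
  ultimately show ?thesis
    using that U V hom by blast
qed

text \<open>Inverts \<open>(x, y) \<mapsto> (x, f (x, y))\<close> and restricts the inverse to
  points \<open>(x, 0)\<close>. The equivalence on \<open>U\<close> contains the uniqueness needed
  for gluing; injectivity in the second variable on all of \<open>U\<close> is what keeps the
  nullity constant away from \<open>S\<close>.\<close>

lemma smooth_implicit_function:
  fixes f :: "'a::euclidean_space \<times> 'b::euclidean_space \<Rightarrow> 'b"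
  assumes W: "open W" "(a, b) \<in> W" and f: "smooth_on W f" and f0: "f (a, b) = 0"
    and inj: "\<And>k. fderiv f (a, b) (0, k) = 0 \<Longrightarrow> k = 0"
  obtains U A h where "open U" "(a, b) \<in> U" "U \<subseteq> W" "open A" "a \<in> A" "smooth_on A h" "h a = b"
    "\<And>x. x \<in> A \<Longrightarrow> (x, h x) \<in> U" "\<And>x y. (x, y) \<in> U \<Longrightarrow> f (x, y) = 0 \<longleftrightarrow> x \<in> A \<and> y = h x"
    "\<And>z k. z \<in> U \<Longrightarrow> fderiv f z (0, k) = 0 \<Longrightarrow> k = 0"
proof -
  define G where "G = (\<lambda>z. (fst z, f z))"
  have G: "smooth_on W G"
    unfolding G_def by (intro smooth_on_Pair W f smooth_on_linear bounded_linear_fst)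
  have dG: "fderiv G z = (\<lambda>v. (fst v, fderiv f z v))" if "z \<in> W" for z
    unfolding G_def
    by (intro fderiv_eqI has_derivative_Pair has_derivative_fst has_derivative_ident
        smooth_on_has_derivative[OF f that])
  have "inj (fderiv G (a, b))"
    unfolding linear_injective_0[OF smooth_on_linear_fderiv[OF G W(2)]]
    using inj by (auto simp: dG[OF W(2)] zero_prod_def)
  then obtain U V g where U: "open U" "(a, b) \<in> U" "U \<subseteq> W" and V: "open V"
    and hom: "homeomorphism U V G g" and g: "smooth_on V g" and injU: "\<And>z. z \<in> U \<Longrightarrow> inj (fderiv G z)"
    using smooth_inverse_function_theorem[OF W G] by blast
  define A where "A = {x. (x, 0) \<in> V}"
  define h where "h = (\<lambda>x. snd (g (x, 0)))"
  have gU: "g y \<in> U" "G (g y) = y" if "y \<in> V" for y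
    using hom that by (auto simp: homeomorphism_def)
  have gG: "g (G z) = z" "G z \<in> V" if "z \<in> U" for z
    using hom that by (auto simp: homeomorphism_def)
  have A: "open A"
    unfolding A_def using open_vimage[OF V, of "\<lambda>x. (x, 0)"]
    by (simp add: vimage_def continuous_on_Pair)
  have h: "smooth_on A h"
    unfolding h_def
  proof (rule smooth_on_compose_linear[OF A bounded_linear_snd])
    show "smooth_on A (\<lambda>x. g (x, 0))"
      by (rule smooth_on_compose[OF A g])
        (auto simp: A_def[symmetric] intro!: smooth_on_Pair A smooth_on_const smooth_on_linear bounded_linear_Pair bounded_linear_ident bounded_linear_zero, auto simp: A_def)
  qed
  have gh: "g (x, 0) = (x, h x)" "f (x, h x) = 0" if "x \<in> A" for x
  proof -
    have *: "fst (g (x, 0)) = x" "f (g (x, 0)) = 0"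
      using gU(2)[of "(x, 0)"] that by (auto simp: A_def G_def)
    then show "g (x, 0) = (x, h x)"
      by (simp add: h_def prod_eq_iff)
    then show "f (x, h x) = 0"
      using * by simp
  qed
  have Aiff: "f (x, y) = 0 \<longleftrightarrow> x \<in> A \<and> y = h x" if "(x, y) \<in> U" for x y
  proof
    assume "f (x, y) = 0"
    then have "G (x, y) = (x, 0)" by (simp add: G_def)
    then show "x \<in> A \<and> y = h x"
      using gG[OF that] by (simp add: A_def h_def)
  qed (use gh in auto)
  show ?thesis
  proof (rule that[OF U A _ h])
    show "a \<in> A" "h a = b"
      using Aiff[OF U(2)] f0 by auto
    show "(x, h x) \<in> U" if "x \<in> A" for x
      using gU(1)[of "(x, 0)"] gh[OF that] that by (simp add: A_def)
    show "k = 0" if z: "z \<in> U" and "fderiv f z (0, k) = 0" for z k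
    proof -
      have zW: "z \<in> W"
        using z U(3) by blast
      have "fderiv G z (0, k) = 0"
        using that(2) by (simp add: dG[OF zW] zero_prod_def)
      then show ?thesis
        using injU[OF z] linear_injective_0[OF smooth_on_linear_fderiv[OF G zW]]
        by (auto simp: zero_prod_def)
    qed
  qed (rule Aiff)
qed

section \<open>Slice charts and tangent spaces\<close>

lemma curve_in_mem: "curve_in S p v \<gamma> \<Longrightarrow> p \<in> S"
  unfolding curve_in_def by (auto simp: image_subset_iff)

lemma tangent_space_mem: "v \<in> tangent_space S p \<Longrightarrow> p \<in> S"
  using curve_in_mem by (auto simp: tangent_space_def)

lemma curve_in_eventually:
  assumes "curve_in S p v \<gamma>" "open W" "p \<in> W"
  shows "\<forall>\<^sub>F t in nhds 0. \<gamma> t \<in> S \<inter> W"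
proof -
  obtain \<epsilon> where \<epsilon>: "\<epsilon> > 0" "\<gamma> ` {-\<epsilon><..<\<epsilon>} \<subseteq> S" and \<gamma>: "\<gamma> 0 = p" "(\<gamma> has_vector_derivative v) (at 0)"
    using assms by (auto simp: curve_in_def)
  have "(\<gamma> \<longlongrightarrow> p) (nhds 0)"
    using has_vector_derivative_continuous[OF \<gamma>(2)] \<gamma>(1)
    by (metis continuous_at tendsto_at_iff_tendsto_nhds)
  then have "\<forall>\<^sub>F t in nhds 0. \<gamma> t \<in> W"
    using assms topological_tendstoD by blast
  moreover have "\<forall>\<^sub>F t in nhds 0. t \<in> {-\<epsilon><..<\<epsilon>}"
    by (rule eventually_nhds_in_open) (use \<epsilon> in auto)
  ultimately show ?thesis
    by eventually_elim (use \<epsilon> in auto)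
qed

lemma has_vector_derivative_along_curve:
  assumes \<gamma>: "curve_in S p v \<gamma>" and W: "open W" "p \<in> W" and g: "smooth_on W g"
    and eq: "\<And>x. x \<in> S \<inter> W \<Longrightarrow> X x = g x"
  shows "((\<lambda>t. X (\<gamma> t)) has_vector_derivative fderiv g p v) (at 0)"
proof -
  have \<gamma>0: "\<gamma> 0 = p" "(\<gamma> has_derivative (\<lambda>t. t *\<^sub>R v)) (at 0)"
    using \<gamma> by (auto simp: curve_in_def has_vector_derivative_def)
  have d: "(g has_derivative fderiv g p) (at p)"
    using g W(2) by (rule smooth_on_has_derivative)
  have "((\<lambda>t. g (\<gamma> t)) has_derivative (\<lambda>t. fderiv g p (t *\<^sub>R v))) (at 0)"
    using diff_chain_at[OF \<gamma>0(2)] d \<gamma>0(1) by (simp add: o_def)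
  then have "((\<lambda>t. g (\<gamma> t)) has_vector_derivative fderiv g p v) (at 0)"
    by (simp add: has_vector_derivative_def linear_cmul[OF has_derivative_linear[OF d]])
  moreover have ev: "\<forall>\<^sub>F t in nhds 0. g (\<gamma> t) = X (\<gamma> t)"
    using curve_in_eventually[OF \<gamma> W] by eventually_elim (simp add: eq)
  have "\<forall>\<^sub>F t in at 0. g (\<gamma> t) = X (\<gamma> t)"
    using ev unfolding eventually_nhds_conv_at by simp
  ultimately show ?thesis
    unfolding has_vector_derivative_def
    by (rule has_derivative_transform_eventually[where f = "\<lambda>t. g (\<gamma> t)" and g = "\<lambda>t. X (\<gamma> t)",
          OF _ _ eventually_nhds_x_imp_x[OF ev] UNIV_I])
qed

text \<open>The chain rule gives the same value along every curve, and tangency of \<open>v\<close>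
  supplies at least one curve, so the description is unique.\<close>

lemma covariant_derivative_eq:
  assumes v: "v \<in> tangent_space S p" and W: "open W" "p \<in> W" and g: "smooth_on W g"
    and eq: "\<And>x. x \<in> S \<inter> W \<Longrightarrow> X x = g x"
  shows "covariant_derivative S p v X = fderiv g p v"
  unfolding covariant_derivative_def
proof (rule the_equality)
  show "\<forall>\<gamma>. curve_in S p v \<gamma> \<longrightarrow> ((\<lambda>t. X (\<gamma> t)) has_vector_derivative fderiv g p v) (at 0)"
    using has_vector_derivative_along_curve[OF _ W g eq] by blast
  fix w assume w: "\<forall>\<gamma>. curve_in S p v \<gamma> \<longrightarrow> ((\<lambda>t. X (\<gamma> t)) has_vector_derivative w) (at 0)"
  obtain \<gamma> where "curve_in S p v \<gamma>"
    using v by (auto simp: tangent_space_def)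
  then show "w = fderiv g p v"
    using w has_vector_derivative_along_curve[OF _ W g eq] vector_derivative_unique_at by blast
qed

lemma fderiv_cong_along:
  assumes "v \<in> tangent_space S p" "open W" "p \<in> W" "smooth_on W f" "smooth_on W g"
    and "\<And>x. x \<in> S \<inter> W \<Longrightarrow> f x = g x"
  shows "fderiv f p v = fderiv g p v"
proof -
  obtain \<gamma> where "curve_in S p v \<gamma>"
    using assms(1) by (auto simp: tangent_space_def)
  note \<gamma> = has_vector_derivative_along_curve[OF this assms(2,3)]
  have "((\<lambda>t. f (\<gamma> t)) has_vector_derivative fderiv g p v) (at 0)"
    by (rule \<gamma>[OF assms(5,6)])
  moreover have "((\<lambda>t. f (\<gamma> t)) has_vector_derivative fderiv f p v) (at 0)"
    by (rule \<gamma>[OF assms(4) refl])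
  ultimately show ?thesis
    using vector_derivative_unique_at by blast
qed

lemma fderiv_inner:
  assumes "smooth_on W X" "smooth_on W Y" "p \<in> W"
  shows "fderiv (\<lambda>x. X x \<bullet> Y x) p v = X p \<bullet> fderiv Y p v + fderiv X p v \<bullet> Y p"
  using fderiv_eqI[OF has_derivative_inner[OF smooth_on_has_derivative smooth_on_has_derivative]] assms
  by metis

text \<open>It trades the derivative of an arbitrarily chosen field for that of a known one. This is
  how the \<open>SOME\<close> in the shape operator and in the second fundamental form is
  eliminated.\<close>

lemma inner_const_along:
  assumes v: "v \<in> tangent_space S p" and W: "open W" "p \<in> W" and XY: "smooth_on W X" "smooth_on W Y"
    and "\<And>x. x \<in> S \<inter> W \<Longrightarrow> X x \<bullet> Y x = c"
  shows "fderiv X p v \<bullet> Y p = - (X p \<bullet> fderiv Y p v)"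
proof -
  have "fderiv (\<lambda>x. X x \<bullet> Y x) p v = fderiv (\<lambda>x. c) p v"
    by (rule fderiv_cong_along[OF v W smooth_on_inner[OF W(1) XY] smooth_on_const[OF W(1)]]) (rule assms)
  then show ?thesis
    using fderiv_inner[OF XY W(2), of v] by simp
qed

section \<open>Orthogonal projections and ambient extensions of sections\<close>

lemma orth_proj:
  fixes W :: "'a::euclidean_space set"
  assumes "subspace W"
  shows "orth_proj W x \<in> W" "x - orth_proj W x \<in> W\<^sup>\<bottom>"
proof -
  obtain w u where wu: "w \<in> W" "u \<in> W\<^sup>\<bottom>" "x = w + u"
    using subspace_sum_orthogonal_comp[OF assms] set_plus_elim by (metis UNIV_I)
  have "\<exists>!w. w \<in> W \<and> x - w \<in> W\<^sup>\<bottom>"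
  proof (rule ex1I[of _ w])
    show "w \<in> W \<and> x - w \<in> W\<^sup>\<bottom>"
      using wu by simp
    fix w' assume w': "w' \<in> W \<and> x - w' \<in> W\<^sup>\<bottom>"
    then have "w' - w \<in> W"
      using wu assms by (simp add: subspace_diff)
    moreover have "(x - w) - (x - w') \<in> W\<^sup>\<bottom>"
      by (rule subspace_diff[OF subspace_orthogonal_comp]) (use w' wu in auto)
    ultimately have "w' - w \<in> W \<inter> W\<^sup>\<bottom>"
      by simp
    then show "w' = w"
      using orthogonal_Int_0[OF assms] by simp
  qed
  then have "orth_proj W x \<in> W \<and> x - orth_proj W x \<in> W\<^sup>\<bottom>"
    unfolding orth_proj_def by (rule theI')
  then show "orth_proj W x \<in> W" "x - orth_proj W x \<in> W\<^sup>\<bottom>"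
    by auto
qed

lemma inner_orth_proj:
  fixes W :: "'a::euclidean_space set"
  assumes "subspace W" "w \<in> W"
  shows "w \<bullet> orth_proj W x = w \<bullet> x"
  using orth_proj(2)[OF assms(1), of x] assms(2)
  by (auto simp: orthogonal_comp_def orthogonal_def inner_diff_right)

lemma orth_proj_eq_0_iff:
  fixes W :: "'a::euclidean_space set"
  assumes "subspace W"
  shows "orth_proj W x = 0 \<longleftrightarrow> (\<forall>w\<in>W. w \<bullet> x = 0)"
  using inner_orth_proj[OF assms] orth_proj(1)[OF assms, of x]
  by (metis inner_eq_zero_iff inner_zero_right)

lemma local_section_extension:
  assumes "local_section S E p X" "p \<in> S" "open B" "p \<in> B"
  obtains W g where "open W" "p \<in> W" "W \<subseteq> B" "smooth_on W g" "\<And>x. x \<in> S \<inter> W \<Longrightarrow> X x = g x"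
    "\<And>x. x \<in> S \<inter> W \<Longrightarrow> g x \<in> E x"
proof -
  obtain U where U: "open U" "p \<in> U" "smooth_along (S \<inter> U) X" "\<And>q. q \<in> S \<inter> U \<Longrightarrow> X q \<in> E q"
    using assms(1) by (auto simp: local_section_def)
  then obtain W g where W: "open W" "p \<in> W" "smooth_on W g" "\<And>x. x \<in> S \<inter> U \<inter> W \<Longrightarrow> g x = X x"
    using assms(2) unfolding smooth_along_def by (metis IntI)
  show ?thesis
  proof (rule that[of "U \<inter> W \<inter> B" g])
    show "smooth_on (U \<inter> W \<inter> B) g"
      by (rule smooth_on_subset[OF W(3)]) blast
  qed (use U W assms in auto)
qed

lemma smooth_on_imp_smooth_along: "open U \<Longrightarrow> smooth_on U f \<Longrightarrow> smooth_along (S \<inter> U) f"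
  unfolding smooth_along_def by blast

text \<open>One fixed witness of the existential in \<open>embedded_submanifold\<close>, without
  base point, since a chart is used at all of its points.\<close>

locale slice_chart =
  fixes S U V :: "'a::euclidean_space set" and \<phi> \<psi> :: "'a \<Rightarrow> 'a" and L :: "'a set"
  assumes open_U: "open U" and open_V: "open V" and homeo: "homeomorphism U V \<phi> \<psi>"
    and smooth_\<phi>: "smooth_on U \<phi>" and smooth_\<psi>: "smooth_on V \<psi>"
    and subspace_L: "subspace L" and slice: "\<phi> ` (S \<inter> U) = L \<inter> V"
begin

lemma \<phi>_mem: "x \<in> U \<Longrightarrow> \<phi> x \<in> V" and \<psi>_mem: "y \<in> V \<Longrightarrow> \<psi> y \<in> U"
  and \<psi>_\<phi>: "x \<in> U \<Longrightarrow> \<psi> (\<phi> x) = x" and \<phi>_\<psi>: "y \<in> V \<Longrightarrow> \<phi> (\<psi> y) = y"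
  using homeo by (auto simp: homeomorphism_def)

lemma \<phi>_L_iff: "x \<in> U \<Longrightarrow> \<phi> x \<in> L \<longleftrightarrow> x \<in> S"
  using slice \<phi>_mem \<psi>_\<phi> by (metis (no_types, lifting) IntD1 IntI imageE image_eqI IntD2)

lemma \<psi>_S_iff: "y \<in> V \<Longrightarrow> \<psi> y \<in> S \<longleftrightarrow> y \<in> L"
  using \<phi>_L_iff[OF \<psi>_mem] \<phi>_\<psi> by simp

lemma fderiv_\<psi>_\<phi>: "x \<in> U \<Longrightarrow> fderiv \<psi> (\<phi> x) (fderiv \<phi> x v) = v"
proof -
  assume x: "x \<in> U"
  have "((\<lambda>x. \<psi> (\<phi> x)) has_derivative (\<lambda>v. fderiv \<psi> (\<phi> x) (fderiv \<phi> x v))) (at x)"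
    using diff_chain_at[OF smooth_on_has_derivative[OF smooth_\<phi> x] smooth_on_has_derivative[OF smooth_\<psi> \<phi>_mem[OF x]]]
    by (simp add: o_def)
  then have "((\<lambda>x. x) has_derivative (\<lambda>v. fderiv \<psi> (\<phi> x) (fderiv \<phi> x v))) (at x)"
    by (rule has_derivative_transform_within_open[OF _ open_U x]) (rule \<psi>_\<phi>)
  from has_derivative_unique[OF this has_derivative_ident] show ?thesis
    by metis
qed

lemma fderiv_\<phi>_\<psi>: "y \<in> V \<Longrightarrow> fderiv \<phi> (\<psi> y) (fderiv \<psi> y v) = v"
proof -
  assume y: "y \<in> V"
  have "((\<lambda>y. \<phi> (\<psi> y)) has_derivative (\<lambda>v. fderiv \<phi> (\<psi> y) (fderiv \<psi> y v))) (at y)"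
    using diff_chain_at[OF smooth_on_has_derivative[OF smooth_\<psi> y] smooth_on_has_derivative[OF smooth_\<phi> \<psi>_mem[OF y]]]
    by (simp add: o_def)
  then have "((\<lambda>y. y) has_derivative (\<lambda>v. fderiv \<phi> (\<psi> y) (fderiv \<psi> y v))) (at y)"
    by (rule has_derivative_transform_within_open[OF _ open_V y]) (rule \<phi>_\<psi>)
  from has_derivative_unique[OF this has_derivative_ident] show ?thesis
    by metis
qed

text \<open>For \<open>u\<close> orthogonal to \<open>L\<close> the function
  \<open>u \<bullet> \<phi> x\<close> vanishes on \<open>S\<close>, so tangent vectors are mapped
  into \<open>L\<close> by the derivative of \<open>\<phi>\<close>. Conversely,
  \<open>\<psi>\<close> carries the segment \<open>y + t *\<^sub>R l\<close> to a curve in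
  \<open>S\<close>.\<close>

lemma tangent_space_\<psi>:
  assumes y: "y \<in> L" "y \<in> V"
  shows "tangent_space S (\<psi> y) = fderiv \<psi> y ` L"
proof (intro equalityI subsetI)
  fix v assume v: "v \<in> tangent_space S (\<psi> y)"
  have "u \<bullet> fderiv \<phi> (\<psi> y) v = 0" if u: "u \<in> L\<^sup>\<bottom>" for u
  proof -
    have "fderiv (\<lambda>x. u) (\<psi> y) v \<bullet> \<phi> (\<psi> y) = - (u \<bullet> fderiv \<phi> (\<psi> y) v)"
    proof (rule inner_const_along[OF v open_U \<psi>_mem[OF y(2)] smooth_on_const[OF open_U] smooth_\<phi>, where c = 0])
      fix x assume "x \<in> S \<inter> U"
      then show "u \<bullet> \<phi> x = 0"
        using \<phi>_L_iff u by (auto simp: orthogonal_comp_def orthogonal_def inner_commute)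
    qed
    then show ?thesis by simp
  qed
  then have "fderiv \<phi> (\<psi> y) v \<in> L\<^sup>\<bottom>\<^sup>\<bottom>"
    by (auto simp: orthogonal_comp_def[of "L\<^sup>\<bottom>"] orthogonal_def)
  then have "fderiv \<phi> (\<psi> y) v \<in> L"
    by (simp add: orthogonal_comp_self subspace_L)
  moreover have "fderiv \<psi> y (fderiv \<phi> (\<psi> y) v) = v"
    using fderiv_\<psi>_\<phi>[OF \<psi>_mem[OF y(2)]] \<phi>_\<psi>[OF y(2)] by simp
  ultimately show "v \<in> fderiv \<psi> y ` L"
    by (metis imageI)
next
  fix v assume "v \<in> fderiv \<psi> y ` L"
  then obtain l where l: "l \<in> L" "v = fderiv \<psi> y l"
    by blast
  define c where "c = (\<lambda>t::real. y + t *\<^sub>R l)"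
  define T where "T = c -` V"
  have contc: "continuous_on UNIV c"
    unfolding c_def by (intro continuous_intros)
  have T: "open T"
    unfolding T_def by (rule open_vimage[OF open_V contc])
  have "0 \<in> T"
    using y by (simp add: T_def c_def)
  then obtain \<epsilon> where \<epsilon>: "\<epsilon> > 0" "ball 0 \<epsilon> \<subseteq> T"
    using T openE by blast
  have int: "{-\<epsilon><..<\<epsilon>} = ball 0 \<epsilon>"
    by (auto simp: dist_real_def)
  have smc: "smooth_on T c"
    unfolding c_def
    by (intro smooth_on_add smooth_on_const T smooth_on_linear bounded_linear_scaleR_left)
  have "curve_in S (\<psi> y) v (\<lambda>t. \<psi> (c t))"
    unfolding curve_in_def
  proof (intro conjI exI[of _ \<epsilon>] \<epsilon>(1))
    show "smooth_on {-\<epsilon><..<\<epsilon>} (\<lambda>t. \<psi> (c t))"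
      unfolding int by (rule smooth_on_subset[OF smooth_on_compose[OF T smooth_\<psi> smc] \<epsilon>(2)]) (simp add: T_def)
    show "(\<lambda>t. \<psi> (c t)) ` {-\<epsilon><..<\<epsilon>} \<subseteq> S"
      unfolding int
    proof clarify
      fix t :: real assume "t \<in> ball 0 \<epsilon>"
      then have "c t \<in> V" using \<epsilon>(2) by (auto simp: T_def)
      moreover have "c t \<in> L"
        using subspace_L y(1) l(1) by (simp add: c_def subspace_add subspace_scale)
      ultimately show "\<psi> (c t) \<in> S"
        using \<psi>_S_iff by simp
    qed
    show "\<psi> (c 0) = \<psi> y"
      by (simp add: c_def)
    have "(c has_derivative (\<lambda>t. t *\<^sub>R l)) (at 0)"
      unfolding c_def by (auto intro!: derivative_eq_intros)
    moreover have d: "(\<psi> has_derivative fderiv \<psi> y) (at (c 0))"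
      using smooth_on_has_derivative[OF smooth_\<psi> y(2)] by (simp add: c_def)
    ultimately have "((\<lambda>t. \<psi> (c t)) has_derivative (\<lambda>t. fderiv \<psi> y (t *\<^sub>R l))) (at 0)"
      using diff_chain_at by (fastforce simp: o_def)
    then show "((\<lambda>t. \<psi> (c t)) has_vector_derivative v) (at 0)"
      by (simp add: has_vector_derivative_def l(2) linear_cmul[OF has_derivative_linear[OF d]])
  qed
  then show "v \<in> tangent_space S (\<psi> y)"
    by (auto simp: tangent_space_def)
qed

lemma tangent_space_eq: "p \<in> S \<inter> U \<Longrightarrow> tangent_space S p = fderiv \<psi> (\<phi> p) ` L"
  using tangent_space_\<psi>[of "\<phi> p"] \<phi>_L_iff \<phi>_mem \<psi>_\<phi> by simp

lemma inj_fderiv_\<psi>: "y \<in> V \<Longrightarrow> inj (fderiv \<psi> y)"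
  by (metis fderiv_\<phi>_\<psi> injI)

lemma subspace_tangent_space: "p \<in> S \<inter> U \<Longrightarrow> subspace (tangent_space S p)"
  using tangent_space_eq subspace_L smooth_on_linear_fderiv[OF smooth_\<psi>] \<phi>_mem
  by (metis IntD2 linear_subspace_image)

lemma dim_tangent_space: "p \<in> S \<inter> U \<Longrightarrow> dim (tangent_space S p) = dim L"
  using tangent_space_eq inj_fderiv_\<psi> smooth_on_linear_fderiv[OF smooth_\<psi>] \<phi>_mem
  by (metis IntD2 dim_image_eq inj_on_subset subset_UNIV)

text \<open>The field that is constant in the chart, with value \<open>v\<close> at
  \<open>p\<close>. It shows that tangent extensions exist, so that \<open>SOME\<close> picks one,
  and it provides test fields.\<close>

definition pushforward :: "'a \<Rightarrow> 'a \<Rightarrow> 'a \<Rightarrow> 'a" where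
  "pushforward p v q = fderiv \<psi> (\<phi> q) (fderiv \<phi> p v)"

lemma smooth_pushforward: "smooth_on U (pushforward p v)"
  unfolding pushforward_def
  by (rule smooth_on_fderiv_apply[OF open_U smooth_\<psi> smooth_\<phi> \<phi>_mem smooth_on_const[OF open_U]])

lemma pushforward_self: "p \<in> U \<Longrightarrow> pushforward p v p = v"
  by (simp add: pushforward_def fderiv_\<psi>_\<phi>)

lemma pushforward_tangent:
  assumes "p \<in> S \<inter> U" "v \<in> tangent_space S p" "q \<in> S \<inter> U"
  shows "pushforward p v q \<in> tangent_space S q"
proof -
  obtain l where l: "l \<in> L" "v = fderiv \<psi> (\<phi> p) l"
    using assms(1,2) tangent_space_eq by blast
  have "fderiv \<phi> p v = l"
    using fderiv_\<phi>_\<psi>[OF \<phi>_mem, of p l] \<psi>_\<phi>[of p] assms(1) by (simp add: l(2))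
  then show ?thesis
    using l(1) assms(3) tangent_space_eq by (simp add: pushforward_def)
qed

lemma local_section_pushforward:
  assumes "p \<in> S \<inter> U" "v \<in> tangent_space S p"
  shows "local_section S (tangent_space S) p (pushforward p v)"
  unfolding local_section_def
proof (intro exI[of _ U] conjI ballI)
  show "smooth_along (S \<inter> U) (pushforward p v)"
    by (rule smooth_on_imp_smooth_along[OF open_U smooth_pushforward])
qed (use assms open_U pushforward_tangent[OF assms] in auto)

end

lemma embedded_submanifold_iff_slice_chart:
  fixes S :: "'a::euclidean_space set"
  shows "embedded_submanifold k S \<longleftrightarrow> (\<forall>p\<in>S. \<exists>U V \<phi> \<psi> L. slice_chart S U V \<phi> \<psi> L \<and> p \<in> U \<and> dim L = k)"
proof (intro iffI ballI)
  fix p assume "embedded_submanifold k S" "p \<in> S"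
  then obtain U V :: "'a set" and \<phi> \<psi> L where "open U" "p \<in> U" "open V" "homeomorphism U V \<phi> \<psi>"
    "smooth_on U \<phi>" "smooth_on V \<psi>" "subspace L" "dim L = k" "\<phi> ` (S \<inter> U) = L \<inter> V"
    unfolding embedded_submanifold_def by metis
  then have "slice_chart S U V \<phi> \<psi> L \<and> p \<in> U \<and> dim L = k"
    by (simp add: slice_chart_def)
  then show "\<exists>U V \<phi> \<psi> L. slice_chart S U V \<phi> \<psi> L \<and> p \<in> U \<and> dim L = k"
    by (intro exI)
next
  assume *: "\<forall>p\<in>S. \<exists>U V \<phi> \<psi> L. slice_chart S U V \<phi> \<psi> L \<and> p \<in> U \<and> dim L = k"
  show "embedded_submanifold k S"
    unfolding embedded_submanifold_def
  proof
    fix p assume "p \<in> S"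
    with * obtain U V \<phi> \<psi> L where "slice_chart S U V \<phi> \<psi> L" "p \<in> U" "dim L = k"
      by metis
    then have "open U \<and> p \<in> U \<and> open V \<and> homeomorphism U V \<phi> \<psi> \<and> smooth_on U \<phi> \<and>
        smooth_on V \<psi> \<and> subspace L \<and> dim L = k \<and> \<phi> ` (S \<inter> U) = L \<inter> V"
      by (simp add: slice_chart_def)
    then show "\<exists>(U::'a set) (V::'a set) \<phi> \<psi> L. open U \<and> p \<in> U \<and> open V \<and> homeomorphism U V \<phi> \<psi> \<and> smooth_on U \<phi> \<and>
        smooth_on V \<psi> \<and> subspace L \<and> dim L = k \<and> \<phi> ` (S \<inter> U) = L \<inter> V"
      by metis
  qed
qed

section \<open>Hypersurfaces as level sets\<close>

text \<open>\<open>\<nu>\<close> is the gradient of \<open>g\<close> and has length one on all of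
  \<open>B\<close>, so ambient derivatives of \<open>\<nu>\<close> may be used at points of
  \<open>M\<close>.\<close>

locale level_hypersurface =
  fixes M B :: "'a::euclidean_space set" and g :: "'a \<Rightarrow> real" and \<nu> :: "'a \<Rightarrow> 'a"
  assumes open_B: "open B" and smooth_g: "smooth_on B g" and smooth_\<nu>: "smooth_on B \<nu>"
    and gradient: "\<And>z. z \<in> B \<Longrightarrow> (g has_derivative (\<lambda>y. \<nu> z \<bullet> y)) (at z)"
    and unit: "\<And>z. z \<in> B \<Longrightarrow> \<nu> z \<bullet> \<nu> z = 1"
    and level: "M \<inter> B = {z \<in> B. g z = 0}"
begin

text \<open>The chart replaces the component of \<open>z\<close> along \<open>\<nu> x\<close> by
  \<open>g z\<close>, which sends the level set into a hyperplane. As \<open>\<nu> x\<close> is the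
  gradient of \<open>g\<close> at \<open>x\<close>, the derivative there is the identity.\<close>

lemma slice_chart:
  assumes x: "x \<in> M \<inter> B"
  shows "\<exists>U V \<phi> \<psi>. slice_chart M U V \<phi> \<psi> {y. \<nu> x \<bullet> y = 0} \<and> x \<in> U"
proof -
  let ?n = "\<nu> x"
  have xB: "x \<in> B" using x by blast
  define \<phi> where "\<phi> = (\<lambda>z. z + (g z - ?n \<bullet> z) *\<^sub>R ?n)"
  have lin: "smooth_on B (\<lambda>z. ?n \<bullet> z)" "smooth_on B (\<lambda>z. z)"
    by (intro smooth_on_linear open_B bounded_linear_inner_right bounded_linear_ident)+
  have sm: "smooth_on B \<phi>"
    unfolding \<phi>_def
    by (intro smooth_on_add smooth_on_scaleR smooth_on_diff smooth_g lin smooth_on_const open_B)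
  have n\<phi>: "?n \<bullet> \<phi> z = g z" for z
    by (simp add: \<phi>_def inner_add_right unit[OF xB])
  have "(\<phi> has_derivative (\<lambda>y. y + (?n \<bullet> y - ?n \<bullet> y) *\<^sub>R ?n)) (at x)"
    unfolding \<phi>_def
    by (intro has_derivative_add has_derivative_scaleR_left has_derivative_diff gradient xB
        has_derivative_ident has_derivative_inner_right)
  then have "fderiv \<phi> x = (\<lambda>y. y)"
    using fderiv_eqI by fastforce
  then have "inj (fderiv \<phi> x)"
    by simp
  then obtain U V \<psi> where U: "open U" "x \<in> U" "U \<subseteq> B" "open V" "homeomorphism U V \<phi> \<psi>" "smooth_on V \<psi>"
    using smooth_inverse_function_theorem[OF open_B xB sm] by metis
  have "\<phi> ` (M \<inter> U) = {y. ?n \<bullet> y = 0} \<inter> V"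
  proof (intro equalityI subsetI)
    fix y assume "y \<in> \<phi> ` (M \<inter> U)"
    then obtain z where z: "z \<in> M \<inter> U" "y = \<phi> z" by blast
    then have "z \<in> M \<inter> B" using U(3) by blast
    then have "g z = 0" using level by blast
    then show "y \<in> {y. ?n \<bullet> y = 0} \<inter> V"
      using z U(5) n\<phi> by (auto simp: homeomorphism_def)
  next
    fix y assume y: "y \<in> {y. ?n \<bullet> y = 0} \<inter> V"
    then have z: "\<psi> y \<in> U" "\<phi> (\<psi> y) = y"
      using U(5) by (auto simp: homeomorphism_def)
    then have "g (\<psi> y) = 0"
      using n\<phi>[of "\<psi> y"] y by simp
    then have "\<psi> y \<in> M"
      using z(1) U(3) level by blast
    then show "y \<in> \<phi> ` (M \<inter> U)"
      using z by (metis IntI imageI)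
  qed
  then have "slice_chart M U V \<phi> \<psi> {y. ?n \<bullet> y = 0}"
    unfolding slice_chart_def
    using U smooth_on_subset[OF sm U(3)] subspace_hyperplane by blast
  then show ?thesis
    using U(2) by blast
qed

lemma dim_hyperplane_\<nu>: "z \<in> B \<Longrightarrow> dim {y. \<nu> z \<bullet> y = 0} = DIM('a) - 1"
  using unit[of z] by (intro dim_hyperplane) auto

text \<open>Vanishing of \<open>g\<close> along curves in \<open>M\<close> gives one inclusion;
  equality follows by dimension.\<close>

lemma tangent_space_hypersurface:
  assumes x: "x \<in> M \<inter> B"
  shows "tangent_space M x = {y. \<nu> x \<bullet> y = 0}"
proof -
  have xB: "x \<in> B" using x by blast
  obtain U V \<phi> \<psi> where "slice_chart M U V \<phi> \<psi> {y. \<nu> x \<bullet> y = 0}" "x \<in> U"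
    using slice_chart[OF x] by blast
  then interpret slice_chart M U V \<phi> \<psi> "{y. \<nu> x \<bullet> y = 0}" by simp
  have xU: "x \<in> M \<inter> U" using x \<open>x \<in> U\<close> by blast
  have "tangent_space M x \<subseteq> {y. \<nu> x \<bullet> y = 0}"
  proof
    fix v assume v: "v \<in> tangent_space M x"
    have "fderiv g x v = fderiv (\<lambda>x. 0) x v"
      by (rule fderiv_cong_along[OF v open_B xB smooth_g smooth_on_const[OF open_B]]) (use level in blast)
    then show "v \<in> {y. \<nu> x \<bullet> y = 0}"
      using fderiv_eqI[OF gradient[OF xB]] by simp
  qed
  then show ?thesis
    using subspace_dim_equal[OF subspace_tangent_space[OF xU] subspace_hyperplane] dim_tangent_space[OF xU]
    by (metis order_refl)
qed

text \<open>Differentiating \<open>Z z \<bullet> \<nu> z = 0\<close> along \<open>M\<close> shows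
  that the derivative of any tangent extension of \<open>y\<close> has component
  \<open>- (y \<bullet> fderiv \<nu> x \<xi>)\<close> along \<open>\<nu> x\<close>.\<close>

lemma second_fundamental_form_eq_0_iff:
  assumes x: "x \<in> M \<inter> B" and \<xi>: "\<xi> \<in> tangent_space M x" and y: "y \<in> tangent_space M x"
  shows "second_fundamental_form M x \<xi> y = 0 \<longleftrightarrow> y \<bullet> fderiv \<nu> x \<xi> = 0"
proof -
  have xB: "x \<in> B" "x \<in> M" using x by auto
  obtain U V \<phi> \<psi> where "slice_chart M U V \<phi> \<psi> {y. \<nu> x \<bullet> y = 0}" "x \<in> U"
    using slice_chart[OF x] by blast
  then interpret slice_chart M U V \<phi> \<psi> "{y. \<nu> x \<bullet> y = 0}" by simp
  have xU: "x \<in> M \<inter> U" using x \<open>x \<in> U\<close> by blast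
  define Y where "Y = (SOME Y. local_section M (tangent_space M) x Y \<and> Y x = y)"
  have "local_section M (tangent_space M) x (pushforward x y) \<and> pushforward x y x = y"
    using local_section_pushforward[OF xU y] pushforward_self \<open>x \<in> U\<close> by blast
  then have Y: "local_section M (tangent_space M) x Y" "Y x = y"
    unfolding Y_def by (metis (mono_tags, lifting) someI_ex)+
  obtain W Z where W: "open W" "x \<in> W" "W \<subseteq> B" and Z: "smooth_on W Z"
    "\<And>z. z \<in> M \<inter> W \<Longrightarrow> Y z = Z z" "\<And>z. z \<in> M \<inter> W \<Longrightarrow> Z z \<in> tangent_space M z"
    using local_section_extension[OF Y(1) xB(2) open_B xB(1)] by metis
  let ?c = "fderiv Z x \<xi>"
  have cov: "covariant_derivative M x \<xi> Y = ?c"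
    by (rule covariant_derivative_eq[OF \<xi> W(1,2) Z(1,2)])
  have "?c \<bullet> \<nu> x = - (Z x \<bullet> fderiv \<nu> x \<xi>)"
  proof (rule inner_const_along[OF \<xi> W(1,2) Z(1) smooth_on_subset[OF smooth_\<nu> W(3)]])
    show "Z z \<bullet> \<nu> z = 0" if "z \<in> M \<inter> W" for z
      using Z(3)[OF that] tangent_space_hypersurface[of z] that W(3) by (auto simp: inner_commute)
  qed
  moreover have "Z x = y"
    using Z(2)[of x] Y(2) W(2) xB(2) by simp
  ultimately have c\<nu>: "\<nu> x \<bullet> ?c = 0 \<longleftrightarrow> y \<bullet> fderiv \<nu> x \<xi> = 0"
    by (simp add: inner_commute)
  have "second_fundamental_form M x \<xi> y = orth_proj ((tangent_space M x)\<^sup>\<bottom>) ?c"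
    unfolding second_fundamental_form_def Y_def[symmetric] Let_def cov ..
  also have "\<dots> = 0 \<longleftrightarrow> ?c \<in> (tangent_space M x)\<^sup>\<bottom>\<^sup>\<bottom>"
    unfolding orth_proj_eq_0_iff[OF subspace_orthogonal_comp]
    by (auto simp: orthogonal_comp_def[of "(tangent_space M x)\<^sup>\<bottom>"] orthogonal_def)
  also have "\<dots> \<longleftrightarrow> \<nu> x \<bullet> ?c = 0"
    using orthogonal_comp_self[OF subspace_tangent_space[OF xU]] tangent_space_hypersurface[OF x] by simp
  finally show ?thesis
    using c\<nu> by simp
qed

text \<open>Unit length makes \<open>fderiv \<nu> x \<xi>\<close> tangent to \<open>M\<close>, so it
  may itself be taken as the test vector \<open>y\<close>.\<close>

lemma index_of_relative_nullity_eq: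
  assumes x: "x \<in> M \<inter> B"
  shows "index_of_relative_nullity M x = dim {\<xi>. \<nu> x \<bullet> \<xi> = 0 \<and> fderiv \<nu> x \<xi> = 0}"
proof -
  have xB: "x \<in> B" using x by blast
  have orth: "\<nu> x \<bullet> fderiv \<nu> x \<xi> = 0" for \<xi>
  proof -
    have "((\<lambda>z. \<nu> z \<bullet> \<nu> z) has_derivative (\<lambda>\<xi>. \<nu> x \<bullet> fderiv \<nu> x \<xi> + fderiv \<nu> x \<xi> \<bullet> \<nu> x)) (at x)"
      by (intro has_derivative_inner smooth_on_has_derivative[OF smooth_\<nu> xB])
    then have "((\<lambda>z. 1) has_derivative (\<lambda>\<xi>. \<nu> x \<bullet> fderiv \<nu> x \<xi> + fderiv \<nu> x \<xi> \<bullet> \<nu> x)) (at x)"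
      by (rule has_derivative_transform_within_open[OF _ open_B xB]) (rule unit)
    from fun_cong[OF has_derivative_unique[OF this has_derivative_const], of \<xi>] show ?thesis
      by (simp add: inner_commute)
  qed
  have "{\<xi> \<in> tangent_space M x. \<forall>y\<in>tangent_space M x. second_fundamental_form M x \<xi> y = 0}
      = {\<xi>. \<nu> x \<bullet> \<xi> = 0 \<and> fderiv \<nu> x \<xi> = 0}"
  proof (intro equalityI subsetI)
    fix \<xi> assume "\<xi> \<in> {\<xi> \<in> tangent_space M x. \<forall>y\<in>tangent_space M x. second_fundamental_form M x \<xi> y = 0}"
    then have \<xi>: "\<xi> \<in> tangent_space M x" "\<And>y. y \<in> tangent_space M x \<Longrightarrow> y \<bullet> fderiv \<nu> x \<xi> = 0"
      using second_fundamental_form_eq_0_iff[OF x] by auto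
    then have "fderiv \<nu> x \<xi> \<bullet> fderiv \<nu> x \<xi> = 0"
      using orth tangent_space_hypersurface[OF x] by blast
    then show "\<xi> \<in> {\<xi>. \<nu> x \<bullet> \<xi> = 0 \<and> fderiv \<nu> x \<xi> = 0}"
      using \<xi>(1) tangent_space_hypersurface[OF x] by simp
  next
    fix \<xi> assume "\<xi> \<in> {\<xi>. \<nu> x \<bullet> \<xi> = 0 \<and> fderiv \<nu> x \<xi> = 0}"
    then show "\<xi> \<in> {\<xi> \<in> tangent_space M x. \<forall>y\<in>tangent_space M x. second_fundamental_form M x \<xi> y = 0}"
      using second_fundamental_form_eq_0_iff[OF x] tangent_space_hypersurface[OF x] by auto
  qed
  then show ?thesis
    by (simp add: index_of_relative_nullity_def)
qed

end

section \<open>Unit normals of the distribution and the shape operator\<close>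

text \<open>\<open>N\<close> is an extension to an open set: unit length is required on all of
  \<open>Q\<close>, orthogonality to \<open>D\<close> only on \<open>S\<close>.\<close>

definition unit_normal :: "'a::euclidean_space set \<Rightarrow> ('a \<Rightarrow> 'a set) \<Rightarrow> 'a set \<Rightarrow> ('a \<Rightarrow> 'a) \<Rightarrow> bool" where
  "unit_normal S D Q N \<longleftrightarrow> open Q \<and> smooth_on Q N \<and> (\<forall>q\<in>Q. N q \<bullet> N q = 1) \<and>
     (\<forall>q\<in>S \<inter> Q. D q = {w. N q \<bullet> w = 0})"

text \<open>The normal solves \<open>z \<bullet> X i q = 0\<close> for \<open>i < m\<close> together
  with \<open>z \<bullet> n = 1\<close>, where \<open>n\<close> is normal to the span at
  \<open>p\<close>. The system is injective at \<open>p\<close>, hence nearby, and its last equation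
  keeps the solution nonzero.\<close>

lemma exists_smooth_normal:
  fixes X :: "nat \<Rightarrow> 'a::euclidean_space \<Rightarrow> 'a"
  assumes W: "open W" "p \<in> W" and X: "\<And>i. i < m \<Longrightarrow> smooth_on W (X i)"
    and m: "DIM('a) = Suc m" "dim (span ((\<lambda>i. X i p) ` {..<m})) = m"
  obtains Q N where "open Q" "p \<in> Q" "Q \<subseteq> W" "smooth_on Q N"
    "\<And>q i. q \<in> Q \<Longrightarrow> i < m \<Longrightarrow> N q \<bullet> X i q = 0" "\<And>q. q \<in> Q \<Longrightarrow> N q \<noteq> 0"
proof -
  let ?E = "span ((\<lambda>i. X i p) ` {..<m})"
  obtain n where n: "n \<noteq> 0" "\<And>w. w \<in> ?E \<Longrightarrow> orthogonal n w"
    using orthogonal_to_subspace_exists[of ?E] m by (auto simp: span_span)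
  obtain e where e: "bij_betw e {..<Suc m} (Basis :: 'a set)"
    using ex_bij_betw_nat_finite[of "Basis :: 'a set"] m(1) by (auto simp: atLeast0LessThan)
  \<comment> \<open>The \<open>m + 1\<close> scalar equations are placed along an enumeration
    \<open>e\<close> of the basis, which makes \<open>A q\<close> an endomorphism, as
    \<open>Ck_on_linear_solve\<close> requires.\<close>
  define A where "A = (\<lambda>q z. (\<Sum>i<m. (z \<bullet> X i q) *\<^sub>R e i) + (z \<bullet> n) *\<^sub>R e m)"
  have ee: "e i \<bullet> e j = (if i = j then 1 else 0)" if "i < Suc m" "j < Suc m" for i j
    using that e bij_betwE[OF e] bij_betw_imp_inj_on[OF e]
    by (auto simp: inner_Basis inj_on_eq_iff)
  have Ae: "A q z \<bullet> e j = (if j < m then z \<bullet> X j q else z \<bullet> n)" if "j < Suc m" for q z j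
  proof -
    have "A q z \<bullet> e j = (\<Sum>i<m. (z \<bullet> X i q) * (if i = j then 1 else 0)) + (z \<bullet> n) * (if m = j then 1 else 0)"
      using that by (simp add: A_def inner_add_left inner_sum_left ee)
    also have "\<dots> = (if j < m then z \<bullet> X j q else z \<bullet> n)"
      using that by (simp add: if_distrib cong: if_cong)
    finally show ?thesis .
  qed
  have lin: "linear (A q)" for q
    unfolding A_def
    by (intro linear_compose_add linear_compose_sum ballI linear_scaleR_left bounded_linear.linear
        bounded_linear_scaleR_const bounded_linear_inner_left)
  have injp: "inj (A p)"
    unfolding linear_injective_0[OF lin]
  proof (intro allI impI)
    fix k assume k: "A p k = 0"
    have "k \<bullet> X i p = 0" if "i < m" for i
      using Ae[of i p k] that k by simp
    \<comment> \<open>If \<open>k \<noteq> 0\<close>, this inclusion is an equality by dimension;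
      but the hyperplane contains \<open>n\<close> and the span does not.\<close>
    then have "?E \<subseteq> {w. k \<bullet> w = 0}"
      by (intro span_minimal subspace_hyperplane) auto
    moreover have "k \<bullet> n = 0"
      using Ae[of m p k] k by simp
    moreover have "n \<notin> ?E"
      using n orthogonal_self by blast
    ultimately show "k = 0"
      using subspace_dim_equal[OF subspace_span subspace_hyperplane] dim_hyperplane[of k] m
      by (metis diff_Suc_1 mem_Collect_eq order_refl)
  qed
  have smA: "smooth_on W (\<lambda>q. A q z)" for z
    unfolding A_def
    by (intro smooth_on_add smooth_on_sum smooth_on_scaleR smooth_on_inner smooth_on_const W X) auto
  obtain C where "C > 0" and C: "\<forall>\<^sub>F q in nhds p. q \<in> W \<and> (\<forall>u. norm u \<le> C * norm (A q u))"
    using linear_family_bounded_below[OF W lin injp smooth_on_continuous_on[OF smA]] by blast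
  then obtain Q where Q: "open Q" "p \<in> Q" "\<And>q. q \<in> Q \<Longrightarrow> q \<in> W \<and> (\<forall>u. norm u \<le> C * norm (A q u))"
    unfolding eventually_nhds by blast
  have inj: "inj (A q)" if "q \<in> Q" for q
    unfolding linear_injective_0[OF lin] using Q(3)[OF that] by (metis mult_zero_right norm_le_zero_iff norm_zero)
  define N where "N = (\<lambda>q. SOME z. A q z = e m)"
  have N: "A q (N q) = e m" if "q \<in> Q" for q
    unfolding N_def using linear_injective_imp_surjective[OF lin inj[OF that]]
    by (metis (mono_tags, lifting) someI_ex surjD)
  have QW: "Q \<subseteq> W" using Q(3) by blast
  have "smooth_on Q N"
    unfolding smooth_on_def
  proof
    show "Ck_on k Q N" for k
      by (rule Ck_on_linear_solve[OF Q(1) lin inj smooth_onD[OF smooth_on_subset[OF smA QW]] Ck_on_const[OF Q(1)] N])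
  qed
  moreover have "N q \<bullet> X i q = 0" if "q \<in> Q" "i < m" for q i
    using Ae[of i q "N q"] that by (simp add: N ee)
  moreover have "N q \<noteq> 0" if "q \<in> Q" for q
    using Ae[of m q "N q"] that by (auto simp: N ee)
  ultimately show ?thesis
    using that Q QW by blast
qed

lemma exists_unit_normal:
  fixes S :: "'a::euclidean_space set"
  assumes D: "smooth_distribution m S D" and m: "DIM('a) = Suc m" and p: "p \<in> S"
  obtains Q N where "unit_normal S D Q N" "p \<in> Q"
proof -
  have Dsub: "subspace (D q)" "dim (D q) = m" if "q \<in> S" for q
    using D that by (auto simp: smooth_distribution_def)
  obtain U X where U: "open U" "p \<in> U" "\<And>i. i < m \<Longrightarrow> smooth_along (S \<inter> U) (X i)"
    "\<And>q. q \<in> S \<inter> U \<Longrightarrow> D q = span ((\<lambda>i. X i q) ` {..<m})"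
    using D p unfolding smooth_distribution_def by metis
  have "\<exists>W g. open W \<and> p \<in> W \<and> smooth_on W g \<and> (\<forall>x\<in>S \<inter> U \<inter> W. g x = X i x)" if "i < m" for i
    using U(2,3) that p by (auto simp: smooth_along_def)
  then obtain W g where W: "\<And>i. i < m \<Longrightarrow> open (W i)" "\<And>i. i < m \<Longrightarrow> p \<in> W i"
    "\<And>i. i < m \<Longrightarrow> smooth_on (W i) (g i)" "\<And>i x. i < m \<Longrightarrow> x \<in> S \<inter> U \<inter> W i \<Longrightarrow> g i x = X i x"
    by metis
  define W' where "W' = U \<inter> (\<Inter>i<m. W i)"
  have W': "open W'" "p \<in> W'"
    unfolding W'_def by (intro open_Int open_INT ballI) (use U W in auto)
  have Dg: "D q = span ((\<lambda>i. g i q) ` {..<m})" if "q \<in> S \<inter> W'" for q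
  proof -
    have "(\<lambda>i. X i q) ` {..<m} = (\<lambda>i. g i q) ` {..<m}"
      using W(4) that by (intro image_cong) (auto simp: W'_def)
    then show ?thesis
      using U(4)[of q] that by (simp add: W'_def)
  qed
  have "smooth_on W' (g i)" if "i < m" for i
    by (rule smooth_on_subset[OF W(3)[OF that]]) (use that in \<open>auto simp: W'_def\<close>)
  then obtain Q N where Q: "open Q" "p \<in> Q" "Q \<subseteq> W'" "smooth_on Q N"
    and N: "\<And>q i. q \<in> Q \<Longrightarrow> i < m \<Longrightarrow> N q \<bullet> g i q = 0" "\<And>q. q \<in> Q \<Longrightarrow> N q \<noteq> 0"
    using exists_smooth_normal[OF W', of m g] m Dg[of p] Dsub(2)[OF p] p W'(2) by auto
  \<comment> \<open>The inverse norm is written as a power of a smooth positive function.\<close>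
  define N1 where "N1 = (\<lambda>q. (N q \<bullet> N q) powr (-1/2) *\<^sub>R N q)"
  have "unit_normal S D Q N1"
    unfolding unit_normal_def
  proof (intro conjI ballI)
    show "open Q" by fact
    show "smooth_on Q N1"
      unfolding N1_def using N(2)
      by (intro smooth_on_scaleR smooth_on_powr smooth_on_inner Q) auto
    show unit: "N1 q \<bullet> N1 q = 1" if "q \<in> Q" for q
    proof -
      have pos: "N q \<bullet> N q > 0" using N(2)[OF that] by simp
      have "(N q \<bullet> N q) powr (-1/2) * (N q \<bullet> N q) powr (-1/2) = (N q \<bullet> N q) powr (-1)"
        by (simp flip: powr_add)
      also have "\<dots> = 1 / (N q \<bullet> N q)"
        using pos by (simp add: powr_minus_divide)
      finally show ?thesis
        using pos by (simp add: N1_def flip: mult.assoc)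
    qed
    fix q assume q: "q \<in> S \<inter> Q"
    have "D q \<subseteq> {w. N1 q \<bullet> w = 0}"
      unfolding Dg[of q, OF subsetD[OF Int_mono[OF order_refl Q(3)] q]]
      using N(1) q by (intro span_minimal subspace_hyperplane) (auto simp: N1_def)
    moreover have "dim {w. N1 q \<bullet> w = 0} = m"
    proof -
      have "N1 q \<noteq> 0" using unit[of q] q by force
      then show ?thesis by (simp add: dim_hyperplane m)
    qed
    ultimately show "D q = {w. N1 q \<bullet> w = 0}"
      using subspace_dim_equal[OF Dsub(1) subspace_hyperplane] Dsub(2) q by auto
  qed
  then show ?thesis
    using that Q(2) by blast
qed

text \<open>Two unit normals differ along \<open>S\<close> by a factor \<open>f\<close> with
  \<open>f q * f q = 1\<close>. Its tangential derivative therefore vanishes, and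
  \<open>c = f p\<close>.\<close>

lemma unit_normal_derivative_unique:
  assumes N: "unit_normal S D Q N" "p \<in> Q" and N': "unit_normal S D Q' N'" "p \<in> Q'"
  obtains c where "c \<noteq> 0" "\<And>v. v \<in> tangent_space S p \<Longrightarrow> fderiv N' p v = c *\<^sub>R fderiv N p v"
proof (cases "p \<in> S")
  case False
  \<comment> \<open>Off \<open>S\<close> there are no tangent vectors, so any nonzero constant
    serves.\<close>
  then show ?thesis
    using that[of 1] tangent_space_mem by fastforce
next
  case p: True
  let ?W = "Q \<inter> Q'"
  have W: "open ?W" "p \<in> ?W"
    using N N' by (auto simp: unit_normal_def)
  have sm: "smooth_on ?W N" "smooth_on ?W N'"
    using N N' by (auto simp: unit_normal_def intro: smooth_on_subset)
  define f where "f = (\<lambda>q. N' q \<bullet> N q)"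
  have smf: "smooth_on ?W f"
    unfolding f_def by (intro smooth_on_inner W sm)
  have N'f: "N' q = f q *\<^sub>R N q" if q: "q \<in> S \<inter> ?W" for q
  proof -
    let ?w = "N' q - f q *\<^sub>R N q"
    have eq: "D q = {w. N q \<bullet> w = 0}" "D q = {w. N' q \<bullet> w = 0}" and 1: "N q \<bullet> N q = 1"
      using q N N' unfolding unit_normal_def by blast+
    have "N q \<bullet> ?w = 0"
      by (simp add: inner_diff_right f_def 1 inner_commute)
    moreover from this have "N' q \<bullet> ?w = 0"
      using eq by blast
    ultimately have "?w \<bullet> ?w = 0"
      by (simp add: inner_diff_left)
    then show ?thesis by simp
  qed
  have ff: "f q \<bullet> f q = 1" if "q \<in> S \<inter> ?W" for q
  proof -
    have "N q \<bullet> N q = 1" "N' q \<bullet> N' q = 1"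
      using that N N' unfolding unit_normal_def by blast+
    then have "1 = (f q *\<^sub>R N q) \<bullet> (f q *\<^sub>R N q)"
      using N'f[OF that] by simp
    then show ?thesis
      using \<open>N q \<bullet> N q = 1\<close> by simp
  qed
  show ?thesis
  proof (rule that)
    show "f p \<noteq> 0"
      using ff[of p] W p by auto
    fix v assume v: "v \<in> tangent_space S p"
    have "fderiv N' p v = fderiv (\<lambda>q. f q *\<^sub>R N q) p v"
      by (rule fderiv_cong_along[OF v W sm(2) smooth_on_scaleR[OF W(1) smf sm(1)] N'f])
    also have "\<dots> = f p *\<^sub>R fderiv N p v + fderiv f p v *\<^sub>R N p"
      using fderiv_eqI[OF has_derivative_scaleR[OF smooth_on_has_derivative[OF smf W(2)]
          smooth_on_has_derivative[OF sm(1) W(2)]]] by simp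
    also have "fderiv f p v = 0"
      using inner_const_along[OF v W smf smf ff] \<open>f p \<noteq> 0\<close> by simp
    finally show "fderiv N' p v = f p *\<^sub>R fderiv N p v"
      by simp
  qed
qed

text \<open>The space \<open>K p\<close> of the overview. Quantifying over the normal attaches it to
  \<open>S\<close> and \<open>D\<close> alone, so that foot points found in different charts can be
  compared.\<close>

definition ruling :: "'a::euclidean_space set \<Rightarrow> ('a \<Rightarrow> 'a set) \<Rightarrow> 'a \<Rightarrow> 'a set" where
  "ruling S D p = {w. \<exists>Q N. unit_normal S D Q N \<and> p \<in> Q \<and> (\<forall>v\<in>tangent_space S p. w \<bullet> fderiv N p v = 0)}"

lemma ruling_iff:
  assumes "unit_normal S D Q N" "p \<in> Q"
  shows "w \<in> ruling S D p \<longleftrightarrow> (\<forall>v\<in>tangent_space S p. w \<bullet> fderiv N p v = 0)"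
proof
  assume "w \<in> ruling S D p"
  then obtain Q' N' where *: "unit_normal S D Q' N'" "p \<in> Q'" "\<forall>v\<in>tangent_space S p. w \<bullet> fderiv N' p v = 0"
    by (auto simp: ruling_def)
  obtain c where "\<And>v. v \<in> tangent_space S p \<Longrightarrow> fderiv N p v = c *\<^sub>R fderiv N' p v"
    using unit_normal_derivative_unique[OF *(1,2) assms] by blast
  then show "\<forall>v\<in>tangent_space S p. w \<bullet> fderiv N p v = 0"
    using *(3) by simp
qed (use assms in \<open>auto simp: ruling_def\<close>)

locale cauchy_data =
  fixes S :: "'a::euclidean_space set" and D :: "'a \<Rightarrow> 'a set" and s m :: nat
  assumes DIM_eq: "DIM('a) = Suc m"
    and submanifold: "embedded_submanifold s S"
    and distribution: "smooth_distribution m S D"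
    and tangent_D: "\<And>p. p \<in> S \<Longrightarrow> tangent_space S p \<subseteq> D p"
    and shape: "\<And>p n. p \<in> S \<Longrightarrow> n \<in> (D p)\<^sup>\<bottom> \<Longrightarrow> n \<noteq> 0 \<Longrightarrow>
      bij_betw (shape_operator S D p n) (tangent_space S p) (tangent_space S p)"
begin

text \<open>The extension picked by \<open>SOME\<close> and the field \<open>N\<close> are both
  orthogonal along \<open>S\<close> to a tangent field extending \<open>t\<close>, because that
  field lies in \<open>D\<close>. Differentiating both orthogonalities gives the same right-hand
  side.\<close>

lemma inner_shape_operator:
  assumes N: "unit_normal S D Q N" and p: "p \<in> S \<inter> Q"
    and v: "v \<in> tangent_space S p" and t: "t \<in> tangent_space S p"
  shows "t \<bullet> shape_operator S D p (N p) v = t \<bullet> fderiv N p v"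
proof -
  obtain U V \<phi> \<psi> L where "slice_chart S U V \<phi> \<psi> L" and pU: "p \<in> U"
    using submanifold p unfolding embedded_submanifold_iff_slice_chart by blast
  then interpret slice_chart S U V \<phi> \<psi> L by simp
  have pSU: "p \<in> S \<inter> U" "p \<in> S" "p \<in> Q" using p pU by auto
  have smN: "smooth_on Q N" "open Q" and ND: "\<And>q. q \<in> S \<inter> Q \<Longrightarrow> D q = {w. N q \<bullet> w = 0}"
    using N by (auto simp: unit_normal_def)
  define N' where "N' = (SOME N'. local_section S (\<lambda>q. (D q)\<^sup>\<bottom>) p N' \<and> N' p = N p)"
  have "local_section S (\<lambda>q. (D q)\<^sup>\<bottom>) p N"
    unfolding local_section_def
  proof (intro exI conjI ballI)
    show "smooth_along (S \<inter> Q) N"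
      by (rule smooth_on_imp_smooth_along[OF smN(2,1)])
    show "N q \<in> (D q)\<^sup>\<bottom>" if "q \<in> S \<inter> Q" for q
      by (auto simp: ND[OF that] orthogonal_comp_def orthogonal_def inner_commute)
  qed (use smN pSU in auto)
  then have N': "local_section S (\<lambda>q. (D q)\<^sup>\<bottom>) p N'" "N' p = N p"
    unfolding N'_def by (metis (mono_tags, lifting) someI_ex)+
  have oQU: "open (Q \<inter> U)" "p \<in> Q \<inter> U"
    using smN(2) open_U pSU pU by auto
  obtain W Z where W: "open W" "p \<in> W" "W \<subseteq> Q \<inter> U" and Z: "smooth_on W Z"
    "\<And>z. z \<in> S \<inter> W \<Longrightarrow> N' z = Z z" "\<And>z. z \<in> S \<inter> W \<Longrightarrow> Z z \<in> (D z)\<^sup>\<bottom>"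
    using local_section_extension[OF N'(1) pSU(2) oQU] by metis
  let ?Y = "pushforward p t"
  have YD: "?Y q \<in> D q" if "q \<in> S \<inter> W" for q
    using pushforward_tangent[OF pSU(1) t, of q] tangent_D[of q] that W(3) by blast
  have smY: "smooth_on W ?Y" and smNW: "smooth_on W N"
    using smooth_on_subset[OF smooth_pushforward] smooth_on_subset[OF smN(1)] W(3) by blast+
  have "fderiv Z p v \<bullet> ?Y p = - (Z p \<bullet> fderiv ?Y p v)"
  proof (rule inner_const_along[OF v W(1,2) Z(1) smY])
    show "Z q \<bullet> ?Y q = 0" if "q \<in> S \<inter> W" for q
      using YD[OF that] Z(3)[OF that] by (auto simp: orthogonal_comp_def orthogonal_def inner_commute)
  qed
  moreover have "fderiv N p v \<bullet> ?Y p = - (N p \<bullet> fderiv ?Y p v)"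
  proof (rule inner_const_along[OF v W(1,2) smNW smY])
    show "N q \<bullet> ?Y q = 0" if "q \<in> S \<inter> W" for q
      using YD[OF that] ND[of q] that W(3) by blast
  qed
  moreover have "Z p = N p"
    using Z(2)[of p] N'(2) W(2) pSU(2) by simp
  ultimately have *: "fderiv Z p v \<bullet> t = fderiv N p v \<bullet> t"
    using pushforward_self[OF pU] by simp
  have "shape_operator S D p (N p) v = orth_proj (tangent_space S p) (fderiv Z p v)"
    unfolding shape_operator_def N'_def[symmetric] Let_def
    using covariant_derivative_eq[OF v W(1,2) Z(1,2)] by simp
  then show ?thesis
    using inner_orth_proj[OF subspace_tangent_space[OF pSU(1)] t] * by (simp add: inner_commute)
qed

text \<open>Surjectivity of the shape operator gives the first claim, injectivity the second. Hence
  the ruling meets the tangent space only in zero, and \<open>fderiv N p\<close> is injective on the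
  tangent space.\<close>

lemma shape_nondegenerate:
  assumes N: "unit_normal S D Q N" and p: "p \<in> S \<inter> Q" and t: "t \<in> tangent_space S p"
  shows "(\<And>v. v \<in> tangent_space S p \<Longrightarrow> t \<bullet> fderiv N p v = 0) \<Longrightarrow> t = 0"
    and "(\<And>u. u \<in> tangent_space S p \<Longrightarrow> u \<bullet> fderiv N p t = 0) \<Longrightarrow> t = 0"
proof -
  let ?A = "shape_operator S D p (N p)" and ?T = "tangent_space S p"
  have "D p = {w. N p \<bullet> w = 0}" "N p \<bullet> N p = 1"
    using N p by (auto simp: unit_normal_def)
  then have "N p \<in> (D p)\<^sup>\<bottom>" "N p \<noteq> 0"
    by (auto simp: orthogonal_comp_def orthogonal_def inner_commute)
  then have bij: "bij_betw ?A ?T ?T"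
    using shape p by blast
  have A: "t \<bullet> ?A v = t \<bullet> fderiv N p v" if "v \<in> ?T" "t \<in> ?T" for t v
    by (rule inner_shape_operator[OF N p that])
  show "t = 0" if *: "\<And>v. v \<in> ?T \<Longrightarrow> t \<bullet> fderiv N p v = 0"
  proof -
    obtain v where v: "v \<in> ?T" "?A v = t"
      using bij t by (metis bij_betw_def imageE)
    then have "t \<bullet> t = 0"
      using A[OF v(1) t] *[OF v(1)] by simp
    then show ?thesis by simp
  qed
  have A0: "?A v = 0" if v: "v \<in> ?T" and *: "\<And>u. u \<in> ?T \<Longrightarrow> u \<bullet> fderiv N p v = 0" for v
  proof -
    have "?A v \<in> ?T"
      using bij v by (rule bij_betw_apply)
    then have "?A v \<bullet> ?A v = 0"
      using A[OF v, of "?A v"] * by simp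
    then show ?thesis by simp
  qed
  show "t = 0" if *: "\<And>u. u \<in> ?T \<Longrightarrow> u \<bullet> fderiv N p t = 0"
  proof -
    obtain U V \<phi> \<psi> L where "slice_chart S U V \<phi> \<psi> L" and pU: "p \<in> U"
      using submanifold p unfolding embedded_submanifold_iff_slice_chart by blast
    then interpret slice_chart S U V \<phi> \<psi> L by simp
    have T0: "0 \<in> ?T"
      using subspace_tangent_space p pU subspace_0 by blast
    have "fderiv N p 0 = 0"
      using N p smooth_on_linear_fderiv[of Q N p] linear_0 unfolding unit_normal_def by blast
    \<comment> \<open>Bijectivity says nothing about the value at zero, so that value is computed as
      well before injectivity is applied.\<close>
    then have "?A 0 = ?A t"
      using A0[OF T0] A0[OF t *] by simp
    then show ?thesis
      using bij t T0 by (metis bij_betw_def inj_on_eq_iff)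
  qed
qed

end

section \<open>The local ruled hypersurface\<close>

lemma has_derivative_partial_fst:
  assumes "(f has_derivative f') (at (a, b))"
  shows "((\<lambda>x. f (x, b)) has_derivative (\<lambda>h. f' (h, 0))) (at a)"
proof -
  have "((\<lambda>x. (x, b)) has_derivative (\<lambda>h. (h, 0))) (at a)"
    by (intro has_derivative_Pair has_derivative_ident has_derivative_const)
  from diff_chain_at[OF this assms] show ?thesis
    by (simp add: o_def)
qed

lemma has_derivative_partial_snd:
  assumes "(f has_derivative f') (at (a, b))"
  shows "((\<lambda>y. f (a, y)) has_derivative (\<lambda>k. f' (0, k))) (at b)"
proof -
  have "((\<lambda>y. (a, y)) has_derivative (\<lambda>k. (0, k))) (at b)"
    by (intro has_derivative_Pair has_derivative_ident has_derivative_const)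
  from diff_chain_at[OF this assms] show ?thesis
    by (simp add: o_def)
qed

locale local_cauchy_data = cauchy_data S D s m + slice_chart S U V \<phi> \<psi> L
  for S :: "'a::euclidean_space set" and D s m U V \<phi> \<psi> L +
  fixes Q :: "'a set" and N :: "'a \<Rightarrow> 'a" and B :: "'a set"
  assumes N: "unit_normal S D Q N"
    and B_orthogonal: "pairwise orthogonal B" and B_norm: "\<And>e. e \<in> B \<Longrightarrow> norm e = 1"
    and B_independent: "independent B" and B_card: "card B = s" and B_span: "span B = L"
begin

text \<open>Orthogonal projection onto \<open>L\<close>. The parameter \<open>y\<close> runs over
  the whole ambient space but enters \<open>\<sigma>\<close> only through \<open>\<pi> y\<close>;
  this lets \<open>H\<close> take values in the space of its unknown.\<close>

definition \<pi> :: "'a \<Rightarrow> 'a" where "\<pi> y = (\<Sum>e\<in>B. (y \<bullet> e) *\<^sub>R e)"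
definition \<sigma> :: "'a \<Rightarrow> 'a" where "\<sigma> y = \<psi> (\<pi> y)"
definition V' :: "'a set" where "V' = {y. \<pi> y \<in> V \<and> \<sigma> y \<in> Q}"
definition n :: "'a \<Rightarrow> 'a" where "n y = N (\<sigma> y)"

text \<open>The two summands of \<open>H (x, y)\<close> are orthogonal; the first vanishes iff \<open>y \<in> L\<close>, the second iff
  \<open>x - \<sigma> y\<close> lies in the ruling at \<open>\<sigma> y\<close>. So \<open>H (x, y) = 0\<close> says that \<open>\<sigma> y\<close> is the foot point of \<open>x\<close>.\<close>

definition H :: "'a \<times> 'a \<Rightarrow> 'a" where
  "H z = (snd z - \<pi> (snd z)) + (\<Sum>e\<in>B. ((fst z - \<sigma> (snd z)) \<bullet> fderiv n (snd z) e) *\<^sub>R e)"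

section \<open>The chart parametrisation of \<open>S\<close> and the normal in the parameter\<close>

lemma finite_B: "finite B"
  using B_independent by (rule independent_imp_finite)

lemma B_inner: "e \<in> B \<Longrightarrow> e' \<in> B \<Longrightarrow> e \<bullet> e' = (if e = e' then 1 else 0)"
  using B_orthogonal B_norm norm_eq_1 by (auto simp: orthogonal_def pairwise_def)

lemma B_L: "e \<in> B \<Longrightarrow> e \<in> L"
  using B_span span_base by blast

lemma sum_B_inner: "e \<in> B \<Longrightarrow> (\<Sum>e'\<in>B. c e' *\<^sub>R e') \<bullet> e = c e"
  using finite_B by (simp add: inner_sum_left B_inner if_distrib cong: if_cong)

lemma bounded_linear_\<pi>: "bounded_linear \<pi>"
  unfolding \<pi>_def[abs_def]
  by (intro bounded_linear_sum bounded_linear_compose[OF bounded_linear_scaleR_left] bounded_linear_inner_left)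

lemma \<pi>_L: "\<pi> y \<in> L"
  unfolding \<pi>_def using B_L subspace_L by (intro subspace_sum subspace_scale)

lemma \<pi>_id: "y \<in> L \<Longrightarrow> \<pi> y = y"
proof -
  assume "y \<in> L"
  have "\<pi> b = b" if b: "b \<in> B" for b
  proof -
    have "\<pi> b = (\<Sum>e\<in>B. if b = e then e else 0)"
      unfolding \<pi>_def by (rule sum.cong) (use b in \<open>auto simp: B_inner\<close>)
    then show ?thesis
      using b finite_B by simp
  qed
  then show "\<pi> y = y"
    using linear_eq_on_span[of \<pi> "\<lambda>x. x" B y] bounded_linear_\<pi> \<open>y \<in> L\<close> B_span
    by (simp add: bounded_linear.linear linear_ident)
qed

lemma \<pi>_eq_iff: "\<pi> y = y \<longleftrightarrow> y \<in> L"
  using \<pi>_L \<pi>_id by metis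

lemma \<pi>_inner: "e \<in> B \<Longrightarrow> \<pi> y \<bullet> e = y \<bullet> e"
  unfolding \<pi>_def by (rule sum_B_inner)

lemma smooth_N: "open Q" "smooth_on Q N"
  using N by (auto simp: unit_normal_def)

lemma open_V': "open V'"
proof -
  have "open (V \<inter> \<psi> -` Q)"
    using continuous_open_preimage smooth_on_continuous_on[OF smooth_\<psi>] open_V smooth_N(1) by blast
  then have "open (\<pi> -` (V \<inter> \<psi> -` Q))"
    by (intro open_vimage linear_continuous_on bounded_linear_\<pi>)
  moreover have "\<pi> -` (V \<inter> \<psi> -` Q) = V'"
    by (auto simp: V'_def \<sigma>_def)
  ultimately show ?thesis by simp
qed

lemma smooth_\<sigma>: "smooth_on V' \<sigma>"
  unfolding \<sigma>_def[abs_def]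
  by (rule smooth_on_compose[OF open_V' smooth_\<psi> smooth_on_linear[OF open_V' bounded_linear_\<pi>]])
    (simp add: V'_def)

lemma smooth_n: "smooth_on V' n"
  unfolding n_def[abs_def]
  by (rule smooth_on_compose[OF open_V' smooth_N(2) smooth_\<sigma>]) (simp add: V'_def)

lemma fderiv_\<sigma>: "y \<in> V' \<Longrightarrow> fderiv \<sigma> y k = fderiv \<psi> (\<pi> y) (\<pi> k)"
proof -
  assume y: "y \<in> V'"
  then have "(\<psi> has_derivative fderiv \<psi> (\<pi> y)) (at (\<pi> y))"
    by (intro smooth_on_has_derivative[OF smooth_\<psi>]) (simp add: V'_def)
  from diff_chain_at[OF bounded_linear_imp_has_derivative[OF bounded_linear_\<pi>] this]
  have "(\<sigma> has_derivative (\<lambda>k. fderiv \<psi> (\<pi> y) (\<pi> k))) (at y)"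
    by (simp add: o_def \<sigma>_def[abs_def])
  from fderiv_eqI[OF this] show "fderiv \<sigma> y k = fderiv \<psi> (\<pi> y) (\<pi> k)"
    by simp
qed

lemma fderiv_n: "y \<in> V' \<Longrightarrow> fderiv n y k = fderiv N (\<sigma> y) (fderiv \<sigma> y k)"
proof -
  assume y: "y \<in> V'"
  then have "(N has_derivative fderiv N (\<sigma> y)) (at (\<sigma> y))"
    by (intro smooth_on_has_derivative[OF smooth_N(2)]) (simp add: V'_def)
  from diff_chain_at[OF smooth_on_has_derivative[OF smooth_\<sigma> y] this]
  have "(n has_derivative (\<lambda>k. fderiv N (\<sigma> y) (fderiv \<sigma> y k))) (at y)"
    by (simp add: o_def n_def[abs_def])
  from fderiv_eqI[OF this] show "fderiv n y k = fderiv N (\<sigma> y) (fderiv \<sigma> y k)"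
    by simp
qed

lemma linear_fderiv_n: "y \<in> V' \<Longrightarrow> linear (fderiv n y)"
  by (rule smooth_on_linear_fderiv[OF smooth_n])

text \<open>\<open>n\<close> depends on \<open>y\<close> only through \<open>\<pi> y\<close>, so
  directions in \<open>B\<close> determine its derivative.\<close>

lemma fderiv_n_\<pi>: "y \<in> V' \<Longrightarrow> fderiv n y k = (\<Sum>e\<in>B. (k \<bullet> e) *\<^sub>R fderiv n y e)"
proof -
  assume y: "y \<in> V'"
  have "fderiv n y k = fderiv n y (\<pi> k)"
    by (simp add: fderiv_n fderiv_\<sigma> y \<pi>_id \<pi>_L)
  then show "fderiv n y k = (\<Sum>e\<in>B. (k \<bullet> e) *\<^sub>R fderiv n y e)"
    unfolding \<pi>_def linear_sum[OF linear_fderiv_n[OF y]] linear_cmul[OF linear_fderiv_n[OF y]] .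
qed

lemma \<sigma>_mem: "y \<in> V' \<Longrightarrow> \<sigma> y \<in> S \<inter> Q"
  using \<psi>_S_iff \<pi>_L by (auto simp: V'_def \<sigma>_def)

lemma tangent_space_\<sigma>: "y \<in> V' \<Longrightarrow> tangent_space S (\<sigma> y) = range (fderiv \<sigma> y)"
proof -
  assume y: "y \<in> V'"
  have "\<pi> ` UNIV = L"
    using \<pi>_L by (auto simp: image_iff) (metis \<pi>_id)
  have "tangent_space S (\<sigma> y) = fderiv \<psi> (\<pi> y) ` \<pi> ` UNIV"
    unfolding \<sigma>_def \<open>\<pi> ` UNIV = L\<close>
    by (rule tangent_space_\<psi>) (use y \<pi>_L in \<open>auto simp: V'_def\<close>)
  then show "tangent_space S (\<sigma> y) = range (fderiv \<sigma> y)"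
    by (simp add: image_image fderiv_\<sigma>[OF y])
qed

lemma fderiv_\<sigma>_eq_0: "y \<in> V' \<Longrightarrow> fderiv \<sigma> y k = 0 \<Longrightarrow> \<pi> k = 0"
proof -
  assume y: "y \<in> V'" and k: "fderiv \<sigma> y k = 0"
  have "\<pi> y \<in> V" using y by (simp add: V'_def)
  then show "\<pi> k = 0"
    using k inj_fderiv_\<psi> smooth_on_linear_fderiv[OF smooth_\<psi>] linear_injective_0
    by (metis fderiv_\<sigma> y)
qed

text \<open>Nondegeneracy in the first argument, read in the chart. Only \<open>\<pi> k\<close> is
  determined because \<open>\<sigma>\<close> is constant along the complement of
  \<open>L\<close>.\<close>

lemma nondegenerate_\<sigma>:
  assumes y: "y \<in> V'" and k: "\<And>e. e \<in> B \<Longrightarrow> fderiv \<sigma> y k \<bullet> fderiv n y e = 0"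
  shows "\<pi> k = 0"
proof -
  have "fderiv \<sigma> y k = 0"
  proof (rule shape_nondegenerate(1)[OF N \<sigma>_mem[OF y]])
    show "fderiv \<sigma> y k \<in> tangent_space S (\<sigma> y)"
      using tangent_space_\<sigma>[OF y] by simp
    fix v assume "v \<in> tangent_space S (\<sigma> y)"
    then obtain l where l: "fderiv N (\<sigma> y) v = fderiv n y l"
      using tangent_space_\<sigma>[OF y] fderiv_n[OF y] by force
    show "fderiv \<sigma> y k \<bullet> fderiv N (\<sigma> y) v = 0"
      unfolding l fderiv_n_\<pi>[OF y, of l] by (simp add: inner_sum_right k)
  qed
  then show ?thesis
    by (rule fderiv_\<sigma>_eq_0[OF y])
qed

lemma n_tangent: "y \<in> V' \<Longrightarrow> n y \<bullet> fderiv \<sigma> y k = 0"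
  using tangent_D[of "\<sigma> y"] \<sigma>_mem[of y] tangent_space_\<sigma>[of y] N
  unfolding unit_normal_def n_def by blast

lemma unit_n: "y \<in> V' \<Longrightarrow> n y \<bullet> n y = 1"
  using N by (auto simp: unit_normal_def n_def V'_def)

text \<open>Tangent vectors do not see multiples of \<open>n y\<close>. The case
  \<open>c = 0\<close> gives injectivity on \<open>L\<close>; the case \<open>c = 1\<close> shows
  that \<open>n y\<close> is independent of the derivatives of \<open>n\<close>.\<close>

lemma nondegenerate_n:
  assumes y: "y \<in> V'" and k: "fderiv n y k = c *\<^sub>R n y"
  shows "\<pi> k = 0"
proof -
  have "fderiv \<sigma> y k = 0"
  proof (rule shape_nondegenerate(2)[OF N \<sigma>_mem[OF y]])
    show "fderiv \<sigma> y k \<in> tangent_space S (\<sigma> y)"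
      using tangent_space_\<sigma>[OF y] by simp
    fix u assume "u \<in> tangent_space S (\<sigma> y)"
    then obtain l where "u = fderiv \<sigma> y l"
      using tangent_space_\<sigma>[OF y] by blast
    then show "u \<bullet> fderiv N (\<sigma> y) (fderiv \<sigma> y k) = 0"
      using k fderiv_n[OF y, of k] n_tangent[OF y, of l] by (simp add: inner_commute)
  qed
  then show ?thesis
    by (rule fderiv_\<sigma>_eq_0[OF y])
qed

text \<open>The space is the orthogonal complement of \<open>n y\<close> and the \<open>s\<close>
  vectors \<open>fderiv n y e\<close>, which are independent; this leaves
  \<open>(m + 1) - (s + 1)\<close> dimensions.\<close>

lemma dim_normal_ruling:
  assumes y: "y \<in> V'"
  shows "dim {\<xi>. n y \<bullet> \<xi> = 0 \<and> (\<forall>e\<in>B. \<xi> \<bullet> fderiv n y e = 0)} = m - s"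
proof -
  let ?C = "fderiv n y ` B"
  have inj: "inj_on (fderiv n y) (span B)"
    unfolding B_span
  proof (rule inj_onI)
    fix a b assume ab: "a \<in> L" "b \<in> L" "fderiv n y a = fderiv n y b"
    then have "\<pi> (a - b) = 0"
      using nondegenerate_n[OF y, of "a - b" 0] linear_diff[OF linear_fderiv_n[OF y]] by simp
    then show "a = b"
      using \<pi>_id subspace_diff[OF subspace_L ab(1,2)] by simp
  qed
  have indC: "independent ?C"
    using linear_independent_injective_image[OF linear_fderiv_n[OF y] B_independent inj] .
  have cardC: "card ?C = s"
    using card_image[OF inj_on_subset[OF inj span_superset]] B_card by simp
  have ny: "n y \<notin> span ?C"
  proof
    assume "n y \<in> span ?C"
    then obtain l where l: "l \<in> L" "fderiv n y l = n y"
      using linear_span_image[OF linear_fderiv_n[OF y], of B] B_span by force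
    then have "l = 0"
      using nondegenerate_n[OF y, of l 1] \<pi>_id by simp
    then have "n y = 0"
      using l linear_0[OF linear_fderiv_n[OF y]] by simp
    then show False
      using unit_n[OF y] by simp
  qed
  have "independent (insert (n y) ?C)"
    by (rule independent_insertI[OF ny indC])
  moreover have "n y \<notin> ?C"
    using ny by (rule contrapos_nn) (rule span_base)
  then have "card (insert (n y) ?C) = Suc s"
    using card_insert_disjoint[OF finite_imageI[OF finite_B]] cardC by metis
  ultimately have "dim (span (insert (n y) ?C)) = Suc s"
    unfolding dim_span using dim_eq_card_independent by metis
  moreover have "dim {z \<in> UNIV. \<forall>x\<in>span (insert (n y) ?C). orthogonal x z} + dim (span (insert (n y) ?C))
      = dim (UNIV :: 'a set)"
    by (rule dim_subspace_orthogonal_to_vectors) auto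
  moreover have "{z \<in> UNIV. \<forall>x\<in>span (insert (n y) ?C). orthogonal x z}
      = {\<xi>. n y \<bullet> \<xi> = 0 \<and> (\<forall>e\<in>B. \<xi> \<bullet> fderiv n y e = 0)}"
  proof (intro equalityI subsetI)
    fix z assume z: "z \<in> {\<xi>. n y \<bullet> \<xi> = 0 \<and> (\<forall>e\<in>B. \<xi> \<bullet> fderiv n y e = 0)}"
    have "span (insert (n y) ?C) \<subseteq> {x. z \<bullet> x = 0}"
      using z by (intro span_minimal subspace_hyperplane) (auto simp: inner_commute)
    then show "z \<in> {z \<in> UNIV. \<forall>x\<in>span (insert (n y) ?C). orthogonal x z}"
      by (auto simp: orthogonal_def inner_commute)
  next
    fix z assume "z \<in> {z \<in> UNIV. \<forall>x\<in>span (insert (n y) ?C). orthogonal x z}"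
    then have "x \<bullet> z = 0" if "x \<in> insert (n y) ?C" for x
      using span_base[OF that] by (simp add: orthogonal_def)
    then show "z \<in> {\<xi>. n y \<bullet> \<xi> = 0 \<and> (\<forall>e\<in>B. \<xi> \<bullet> fderiv n y e = 0)}"
      by (simp add: inner_commute[of z])
  qed
  ultimately show ?thesis
    using DIM_eq by simp
qed

lemma ruling_\<sigma>:
  assumes y: "y \<in> V'"
  shows "w \<in> ruling S D (\<sigma> y) \<longleftrightarrow> (\<forall>e\<in>B. w \<bullet> fderiv n y e = 0)"
proof -
  have "w \<in> ruling S D (\<sigma> y) \<longleftrightarrow> (\<forall>k. w \<bullet> fderiv n y k = 0)"
    unfolding ruling_iff[OF N, OF IntD2[OF \<sigma>_mem[OF y]]] tangent_space_\<sigma>[OF y]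
    by (simp add: fderiv_n[OF y])
  also have "\<dots> \<longleftrightarrow> (\<forall>e\<in>B. w \<bullet> fderiv n y e = 0)"
  proof (intro iffI allI)
    fix k assume "\<forall>e\<in>B. w \<bullet> fderiv n y e = 0"
    then show "w \<bullet> fderiv n y k = 0"
      unfolding fderiv_n_\<pi>[OF y, of k] by (simp add: inner_sum_right)
  qed auto
  finally show ?thesis .
qed

section \<open>The foot point equation and its partial derivatives\<close>

lemma smooth_H: "smooth_on (UNIV \<times> V') H"
proof -
  have W: "open (UNIV \<times> V')"
    using open_V' by (simp add: open_Times)
  have fst: "smooth_on (UNIV \<times> V') fst" and snd: "smooth_on (UNIV \<times> V') snd"
    by (intro smooth_on_linear W bounded_linear_fst bounded_linear_snd)+
  have s: "smooth_on (UNIV \<times> V') (\<lambda>z. \<sigma> (snd z))"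
    by (rule smooth_on_compose[OF W smooth_\<sigma> snd]) auto
  have d: "smooth_on (UNIV \<times> V') (\<lambda>z. fderiv n (snd z) e)" for e
    by (rule smooth_on_compose[OF W smooth_on_fderiv[OF smooth_n] snd]) auto
  show ?thesis
    unfolding H_def[abs_def]
    by (intro smooth_on_add smooth_on_diff smooth_on_sum smooth_on_scaleR smooth_on_inner smooth_on_const
        smooth_on_compose_linear[OF _ bounded_linear_\<pi>] W fst snd s d)
qed

lemma H_eq_0_iff:
  assumes y: "y \<in> V'"
  shows "H (x, y) = 0 \<longleftrightarrow> y \<in> L \<and> x - \<sigma> y \<in> ruling S D (\<sigma> y)"
proof
  assume 0: "H (x, y) = 0"
  have "(x - \<sigma> y) \<bullet> fderiv n y e = 0" if e: "e \<in> B" for e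
  proof -
    have "H (x, y) \<bullet> e = (x - \<sigma> y) \<bullet> fderiv n y e"
      by (simp add: H_def inner_add_left inner_diff_left[of y] \<pi>_inner[OF e] sum_B_inner[OF e])
    then show ?thesis using 0 by simp
  qed
  then show "y \<in> L \<and> x - \<sigma> y \<in> ruling S D (\<sigma> y)"
    using 0 by (simp add: ruling_\<sigma>[OF y] H_def \<pi>_eq_iff[symmetric])
next
  assume "y \<in> L \<and> x - \<sigma> y \<in> ruling S D (\<sigma> y)"
  then show "H (x, y) = 0"
    by (simp add: H_def ruling_\<sigma>[OF y] \<pi>_id)
qed

text \<open>\<open>H\<close> is affine in \<open>x\<close>, so the formula holds for every
  \<open>x\<close>. Its kernel in \<open>\<xi>\<close> is the ruling at
  \<open>\<sigma> y\<close>.\<close>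

lemma fderiv_H_fst:
  assumes y: "y \<in> V'"
  shows "fderiv H (x, y) (\<xi>, 0) = (\<Sum>e\<in>B. (\<xi> \<bullet> fderiv n y e) *\<^sub>R e)"
proof -
  have 1: "((\<lambda>x. H (x, y)) has_derivative (\<lambda>\<xi>. fderiv H (x, y) (\<xi>, 0))) (at x)"
    by (intro has_derivative_partial_fst smooth_on_has_derivative[OF smooth_H]) (use y in auto)
  have "((\<lambda>x. H (x, y)) has_derivative (\<lambda>\<xi>. 0 + (\<Sum>e\<in>B. ((\<xi> - 0) \<bullet> fderiv n y e) *\<^sub>R e))) (at x)"
    unfolding H_def fst_conv snd_conv
    by (intro has_derivative_add has_derivative_const has_derivative_sum has_derivative_scaleR_left
        has_derivative_inner_left has_derivative_diff has_derivative_ident)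
  from fun_cong[OF has_derivative_unique[OF 1 this], of \<xi>] show ?thesis
    by simp
qed

text \<open>At \<open>x = \<sigma> y\<close> the term with the second derivative of \<open>n\<close>
  carries the factor \<open>x - \<sigma> y = 0\<close>.\<close>

lemma fderiv_H_snd:
  assumes y: "y \<in> V'"
  shows "fderiv H (\<sigma> y, y) (0, k) = (k - \<pi> k) - (\<Sum>e\<in>B. (fderiv \<sigma> y k \<bullet> fderiv n y e) *\<^sub>R e)"
proof -
  have 1: "((\<lambda>z. H (\<sigma> y, z)) has_derivative (\<lambda>k. fderiv H (\<sigma> y, y) (0, k))) (at y)"
    by (intro has_derivative_partial_snd smooth_on_has_derivative[OF smooth_H]) (use y in auto)
  have "((\<lambda>z. H (\<sigma> y, z)) has_derivative
      (\<lambda>k. (k - \<pi> k) + (\<Sum>e\<in>B. ((\<sigma> y - \<sigma> y) \<bullet> fderiv (\<lambda>z. fderiv n z e) y k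
        + (0 - fderiv \<sigma> y k) \<bullet> fderiv n y e) *\<^sub>R e))) (at y)"
    unfolding H_def fst_conv snd_conv
    by (intro has_derivative_add has_derivative_const has_derivative_sum has_derivative_scaleR_left
        has_derivative_inner has_derivative_diff has_derivative_ident
        bounded_linear_imp_has_derivative[OF bounded_linear_\<pi>]
        smooth_on_has_derivative[OF smooth_\<sigma> y] smooth_on_has_derivative[OF smooth_on_fderiv[OF smooth_n] y])
  from fun_cong[OF has_derivative_unique[OF 1 this], of k] show ?thesis
    by (simp add: sum_negf)
qed

text \<open>Transversality of ruling and tangent space becomes solvability for the foot point:
  pairing with \<open>e \<in> B\<close> isolates the second sum and forces
  \<open>\<pi> k = 0\<close>, and what remains is \<open>k - \<pi> k\<close>.\<close>

lemma fderiv_H_snd_eq_0: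
  assumes y: "y \<in> V'" and 0: "fderiv H (\<sigma> y, y) (0, k) = 0"
  shows "k = 0"
proof -
  have *: "fderiv \<sigma> y k \<bullet> fderiv n y e = 0" if e: "e \<in> B" for e
  proof -
    have "fderiv H (\<sigma> y, y) (0, k) \<bullet> e = - (fderiv \<sigma> y k \<bullet> fderiv n y e)"
      unfolding fderiv_H_snd[OF y]
      by (simp add: inner_diff_left[of _ _ e] \<pi>_inner[OF e] sum_B_inner[OF e])
    then show ?thesis using 0 by simp
  qed
  then have "k - \<pi> k = 0"
    using 0 by (simp add: fderiv_H_snd[OF y])
  then show ?thesis
    using nondegenerate_\<sigma>[OF y *] by simp
qed

end

text \<open>Collects, free of charts, what the gluing and \<open>level_hypersurface\<close> need;
  \<open>r\<close> is the prospective nullity.\<close>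

definition ruled_germ :: "'a::euclidean_space set \<Rightarrow> ('a \<Rightarrow> 'a set) \<Rightarrow> nat \<Rightarrow> 'a set \<Rightarrow> ('a \<Rightarrow> 'a) \<Rightarrow> ('a \<Rightarrow> 'a) \<Rightarrow> bool" where
  "ruled_germ S D r A P \<nu> \<longleftrightarrow> open A \<and> smooth_on A P \<and> smooth_on A \<nu> \<and>
     (\<forall>x\<in>A. P x \<in> S \<and> x - P x \<in> ruling S D (P x) \<and> D (P x) = {w. \<nu> x \<bullet> w = 0} \<and> \<nu> x \<bullet> \<nu> x = 1 \<and>
       ((\<lambda>z. \<nu> z \<bullet> (z - P z)) has_derivative (\<lambda>y. \<nu> x \<bullet> y)) (at x) \<and>
       dim {\<xi>. \<nu> x \<bullet> \<xi> = 0 \<and> fderiv \<nu> x \<xi> = 0} = r)"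

lemma ruled_germ_subset: "ruled_germ S D r A P \<nu> \<Longrightarrow> open A' \<Longrightarrow> A' \<subseteq> A \<Longrightarrow> ruled_germ S D r A' P \<nu>"
  unfolding ruled_germ_def using smooth_on_subset by blast

context local_cauchy_data
begin

text \<open>Differentiating \<open>H (x, h x) = 0\<close>, with \<open>H\<close> injective in its
  second variable, identifies the kernel of \<open>fderiv h x\<close> with the ruling. Injectivity
  of the derivative of \<open>n\<close> on \<open>L\<close> carries this kernel over to the
  normal.\<close>

lemma ruled_germ_implicit:
  assumes A: "open A" and h: "smooth_on A h" and hV': "\<And>x. x \<in> A \<Longrightarrow> h x \<in> V'"
    and H0: "\<And>x. x \<in> A \<Longrightarrow> H (x, h x) = 0"
    and inj: "\<And>x k. x \<in> A \<Longrightarrow> fderiv H (x, h x) (0, k) = 0 \<Longrightarrow> k = 0"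
  shows "ruled_germ S D (m - s) A (\<lambda>x. \<sigma> (h x)) (\<lambda>x. n (h x))"
proof -
  have hL: "h x \<in> L" "x - \<sigma> (h x) \<in> ruling S D (\<sigma> (h x))" if "x \<in> A" for x
    using H_eq_0_iff[OF hV'[OF that]] H0[OF that] by auto
  have dh: "(h has_derivative fderiv h x) (at x)" if "x \<in> A" for x
    by (rule smooth_on_has_derivative[OF h that])
  have dh0_iff: "fderiv h x \<xi> = 0 \<longleftrightarrow> (\<forall>e\<in>B. \<xi> \<bullet> fderiv n (h x) e = 0)" if x: "x \<in> A" for x \<xi>
  proof -
    let ?H' = "fderiv H (x, h x)"
    have dH: "(H has_derivative ?H') (at (x, h x))"
      by (rule smooth_on_has_derivative[OF smooth_H]) (use hV'[OF x] in auto)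
    have "((\<lambda>x. (x, h x)) has_derivative (\<lambda>\<xi>. (\<xi>, fderiv h x \<xi>))) (at x)"
      by (intro has_derivative_Pair has_derivative_ident dh x)
    from diff_chain_at[OF this dH]
    have "((\<lambda>x. H (x, h x)) has_derivative (\<lambda>\<xi>. ?H' (\<xi>, fderiv h x \<xi>))) (at x)"
      by (simp add: o_def)
    then have "((\<lambda>x. 0) has_derivative (\<lambda>\<xi>. ?H' (\<xi>, fderiv h x \<xi>))) (at x)"
      by (rule has_derivative_transform_within_open[OF _ A x]) (rule H0)
    from fun_cong[OF has_derivative_unique[OF this has_derivative_const], of \<xi>]
    have "?H' ((\<xi>, 0) + (0, fderiv h x \<xi>)) = 0"
      by simp
    then have sum0: "?H' (\<xi>, 0) + ?H' (0, fderiv h x \<xi>) = 0"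
      by (simp only: linear_add[OF has_derivative_linear[OF dH]])
    have "fderiv h x \<xi> = 0 \<longleftrightarrow> ?H' (\<xi>, 0) = 0"
    proof
      assume "fderiv h x \<xi> = 0"
      then show "?H' (\<xi>, 0) = 0"
        using sum0 linear_0[OF has_derivative_linear[OF dH]] by (simp add: zero_prod_def)
    next
      assume "?H' (\<xi>, 0) = 0"
      then have "?H' (0, fderiv h x \<xi>) = 0"
        using sum0 by simp
      then show "fderiv h x \<xi> = 0"
        by (rule inj[OF x])
    qed
    also have "\<dots> \<longleftrightarrow> (\<forall>e\<in>B. \<xi> \<bullet> fderiv n (h x) e = 0)"
    proof
      assume 0: "?H' (\<xi>, 0) = 0"
      show "\<forall>e\<in>B. \<xi> \<bullet> fderiv n (h x) e = 0"
      proof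
        fix e assume e: "e \<in> B"
        have "?H' (\<xi>, 0) \<bullet> e = \<xi> \<bullet> fderiv n (h x) e"
          unfolding fderiv_H_fst[OF hV'[OF x]] by (rule sum_B_inner[OF e])
        then show "\<xi> \<bullet> fderiv n (h x) e = 0" using 0 by simp
      qed
    qed (simp add: fderiv_H_fst[OF hV'[OF x]])
    finally show ?thesis .
  qed
  have dhL: "\<pi> (fderiv h x \<xi>) = fderiv h x \<xi>" if x: "x \<in> A" for x \<xi>
  proof -
    have "((\<lambda>x. \<pi> (h x)) has_derivative (\<lambda>\<xi>. \<pi> (fderiv h x \<xi>))) (at x)"
      by (rule bounded_linear.has_derivative[OF bounded_linear_\<pi> dh[OF x]])
    then have "(h has_derivative (\<lambda>\<xi>. \<pi> (fderiv h x \<xi>))) (at x)"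
      by (rule has_derivative_transform_within_open[OF _ A x]) (rule \<pi>_id[OF hL(1)])
    from fun_cong[OF has_derivative_unique[OF this dh[OF x]], of \<xi>] show ?thesis .
  qed
  have dn: "((\<lambda>x. n (h x)) has_derivative (\<lambda>\<xi>. fderiv n (h x) (fderiv h x \<xi>))) (at x)" if x: "x \<in> A" for x
    using diff_chain_at[OF dh[OF x] smooth_on_has_derivative[OF smooth_n hV'[OF x]]] by (simp add: o_def)
  have d\<sigma>: "((\<lambda>x. \<sigma> (h x)) has_derivative (\<lambda>\<xi>. fderiv \<sigma> (h x) (fderiv h x \<xi>))) (at x)" if x: "x \<in> A" for x
    using diff_chain_at[OF dh[OF x] smooth_on_has_derivative[OF smooth_\<sigma> hV'[OF x]]] by (simp add: o_def)
  show ?thesis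
    unfolding ruled_germ_def
  proof (intro conjI ballI)
    show "open A" by fact
    show "smooth_on A (\<lambda>x. \<sigma> (h x))" "smooth_on A (\<lambda>x. n (h x))"
      using smooth_on_compose[OF A smooth_\<sigma> h] smooth_on_compose[OF A smooth_n h] hV' by auto
    fix x assume x: "x \<in> A"
    note y = hV'[OF x]
    show "\<sigma> (h x) \<in> S" "n (h x) \<bullet> n (h x) = 1"
      using \<sigma>_mem[OF y] unit_n[OF y] by auto
    show "x - \<sigma> (h x) \<in> ruling S D (\<sigma> (h x))"
      using hL[OF x] by blast
    show "D (\<sigma> (h x)) = {w. n (h x) \<bullet> w = 0}"
      using N \<sigma>_mem[OF y] unfolding unit_normal_def n_def by blast
    show "((\<lambda>z. n (h z) \<bullet> (z - \<sigma> (h z))) has_derivative (\<lambda>y. n (h x) \<bullet> y)) (at x)"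
    proof -
      have "fderiv n (h x) e \<bullet> (x - \<sigma> (h x)) = 0" if "e \<in> B" for e
        using hL(2)[OF x] that unfolding ruling_\<sigma>[OF y] by (metis inner_commute)
      then have "fderiv n (h x) k \<bullet> (x - \<sigma> (h x)) = 0" for k
        unfolding fderiv_n_\<pi>[OF y, of k] by (simp add: inner_sum_left)
      then have "n (h x) \<bullet> (\<xi> - fderiv \<sigma> (h x) (fderiv h x \<xi>)) + fderiv n (h x) (fderiv h x \<xi>) \<bullet> (x - \<sigma> (h x))
          = n (h x) \<bullet> \<xi>" for \<xi>
        by (simp add: inner_diff_right n_tangent[OF y])
      moreover have "((\<lambda>z. n (h z) \<bullet> (z - \<sigma> (h z))) has_derivative
          (\<lambda>\<xi>. n (h x) \<bullet> (\<xi> - fderiv \<sigma> (h x) (fderiv h x \<xi>)) + fderiv n (h x) (fderiv h x \<xi>) \<bullet> (x - \<sigma> (h x)))) (at x)"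
        by (intro has_derivative_inner has_derivative_diff has_derivative_ident dn d\<sigma> x)
      ultimately show ?thesis by simp
    qed
    have "fderiv n (h x) (fderiv h x \<xi>) = 0 \<longleftrightarrow> (\<forall>e\<in>B. \<xi> \<bullet> fderiv n (h x) e = 0)" for \<xi>
    proof -
      have "fderiv n (h x) (fderiv h x \<xi>) = 0 \<longleftrightarrow> fderiv h x \<xi> = 0"
        using nondegenerate_n[OF y, of "fderiv h x \<xi>" 0] dhL[OF x, of \<xi>] linear_0[OF linear_fderiv_n[OF y]]
        by auto
      then show ?thesis
        using dh0_iff[OF x] by simp
    qed
    then show "dim {\<xi>. n (h x) \<bullet> \<xi> = 0 \<and> fderiv (\<lambda>x. n (h x)) x \<xi> = 0} = m - s"
      unfolding fderiv_eqI[OF dn[OF x]] using dim_normal_ruling[OF y] by simp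
  qed
qed

text \<open>The implicit function theorem gives uniqueness of coordinates inside a box. The radius
  \<open>\<rho>\<close> is so small that points of \<open>S\<close> in the ball have coordinates in
  that box, which turns it into uniqueness among points of \<open>S\<close>.\<close>

lemma local_ruled_germ:
  assumes p: "p \<in> S" "p \<in> U" "p \<in> Q"
  obtains A P \<nu> \<rho> where "ruled_germ S D (m - s) A P \<nu>" "p \<in> A" "P p = p" "0 < \<rho>"
    "\<And>x q. x \<in> ball p \<rho> \<Longrightarrow> q \<in> S \<inter> ball p \<rho> \<Longrightarrow> x - q \<in> ruling S D q \<Longrightarrow> x \<in> A \<and> q = P x"
proof -
  have \<phi>: "\<phi> q \<in> V'" "\<phi> q \<in> L" "\<sigma> (\<phi> q) = q" if "q \<in> S" "q \<in> U" "q \<in> Q" for q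
    using that \<phi>_mem \<phi>_L_iff \<psi>_\<phi> \<pi>_id by (auto simp: V'_def \<sigma>_def)
  note \<phi>p = \<phi>[OF p]
  have ruling0: "0 \<in> ruling S D q" if "q \<in> Q" for q
    using ruling_iff[OF N that] by simp
  have W: "open (UNIV \<times> V')" "(p, \<phi> p) \<in> UNIV \<times> V'"
    using open_V' \<phi>p by (auto simp: open_Times)
  have H0: "H (p, \<phi> p) = 0"
    unfolding H_eq_0_iff[OF \<phi>p(1)] using \<phi>p ruling0 p by simp
  have injp: "k = 0" if "fderiv H (p, \<phi> p) (0, k) = 0" for k
    using fderiv_H_snd_eq_0[OF \<phi>p(1), of k] that \<phi>p(3) by simp
  obtain Z A h where Z: "open Z" "(p, \<phi> p) \<in> Z" "Z \<subseteq> UNIV \<times> V'" and A: "open A" "p \<in> A" "smooth_on A h" "h p = \<phi> p"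
    and hZ: "\<And>x. x \<in> A \<Longrightarrow> (x, h x) \<in> Z" and Hiff: "\<And>x y. (x, y) \<in> Z \<Longrightarrow> H (x, y) = 0 \<longleftrightarrow> x \<in> A \<and> y = h x"
    and inj: "\<And>z k. z \<in> Z \<Longrightarrow> fderiv H z (0, k) = 0 \<Longrightarrow> k = 0"
    using smooth_implicit_function[OF W smooth_H H0 injp] by metis
  have germ: "ruled_germ S D (m - s) A (\<lambda>x. \<sigma> (h x)) (\<lambda>x. n (h x))"
  proof (rule ruled_germ_implicit[OF A(1,3)])
    show "h x \<in> V'" if "x \<in> A" for x
      using hZ[OF that] Z(3) by blast
    show "H (x, h x) = 0" if "x \<in> A" for x
      using Hiff[OF hZ[OF that]] that by simp
    show "k = 0" if "x \<in> A" "fderiv H (x, h x) (0, k) = 0" for x k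
      using inj[OF hZ] that by blast
  qed
  obtain A1 B1 where AB: "open A1" "open B1" "p \<in> A1" "\<phi> p \<in> B1" "A1 \<times> B1 \<subseteq> Z"
    using open_prod_elim[OF Z(1,2)] by (metis mem_Sigma_iff)
  have "open (U \<inter> \<phi> -` B1)"
    using continuous_open_preimage[OF smooth_on_continuous_on[OF smooth_\<phi>] open_U AB(2)] .
  then have "open (A1 \<inter> (U \<inter> \<phi> -` B1) \<inter> Q)"
    using AB(1) smooth_N(1) by blast
  then obtain \<rho> where \<rho>: "0 < \<rho>" "ball p \<rho> \<subseteq> A1 \<inter> (U \<inter> \<phi> -` B1) \<inter> Q"
    using p AB openE[of "A1 \<inter> (U \<inter> \<phi> -` B1) \<inter> Q" p] by blast
  show ?thesis
  proof (rule that[OF germ A(2) _ \<rho>(1)])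
    show "\<sigma> (h p) = p"
      using A(4) \<phi>p by simp
    fix x q assume x: "x \<in> ball p \<rho>" and q: "q \<in> S \<inter> ball p \<rho>" and r: "x - q \<in> ruling S D q"
    have q': "q \<in> S" "q \<in> U" "q \<in> Q" and "x \<in> A1" "\<phi> q \<in> B1"
      using x q \<rho>(2) by auto
    then have "(x, \<phi> q) \<in> Z"
      using AB(5) by blast
    moreover have "H (x, \<phi> q) = 0"
      using \<phi>[OF q'] r by (simp add: H_eq_0_iff)
    ultimately show "x \<in> A \<and> q = \<sigma> (h x)"
      using Hiff \<phi>(3)[OF q'] by metis
  qed
qed

end

section \<open>Gluing\<close>

context cauchy_data
begin

text \<open>Continuity of \<open>P\<close> and \<open>P p = p\<close> allow the germ to be cut down
  to radius \<open>\<delta>\<close>, while uniqueness is kept among all points of \<open>S\<close>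
  within the larger radius \<open>\<rho>\<close>.\<close>

lemma exists_ruled_germ:
  assumes p: "p \<in> S"
  obtains P \<nu> \<rho> \<delta> where "0 < \<delta>" "\<delta> \<le> \<rho> / 4" "ruled_germ S D (m - s) (ball p \<delta>) P \<nu>" "P p = p"
    "\<And>x. x \<in> ball p \<delta> \<Longrightarrow> P x \<in> ball p (\<rho> / 4)"
    "\<And>x q. x \<in> ball p \<delta> \<Longrightarrow> q \<in> S \<inter> ball p \<rho> \<Longrightarrow> x - q \<in> ruling S D q \<Longrightarrow> q = P x"
proof -
  obtain U V \<phi> \<psi> L where chart: "slice_chart S U V \<phi> \<psi> L" "p \<in> U" "dim L = s"
    using submanifold p unfolding embedded_submanifold_iff_slice_chart by blast
  obtain Q N where N: "unit_normal S D Q N" and pQ: "p \<in> Q"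
    using exists_unit_normal[OF distribution DIM_eq p] by blast
  obtain B where B: "pairwise orthogonal B" "\<And>e. e \<in> B \<Longrightarrow> norm e = 1" "independent B" "card B = dim L" "span B = L"
    using orthonormal_basis_subspace[OF slice_chart.subspace_L[OF chart(1)]] by metis
  interpret local_cauchy_data S D s m U V \<phi> \<psi> L Q N B
    using chart(1) N B chart(3)
    by (intro local_cauchy_data.intro local_cauchy_data_axioms.intro cauchy_data_axioms) auto
  obtain A P \<nu> \<rho> where germ: "ruled_germ S D (m - s) A P \<nu>" "p \<in> A" "P p = p" and \<rho>: "0 < \<rho>"
    and uniq: "\<And>x q. x \<in> ball p \<rho> \<Longrightarrow> q \<in> S \<inter> ball p \<rho> \<Longrightarrow> x - q \<in> ruling S D q \<Longrightarrow> x \<in> A \<and> q = P x"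
    using local_ruled_germ[OF p chart(2) pQ] by metis
  have A: "open A" "smooth_on A P"
    using germ(1) by (auto simp: ruled_germ_def)
  have "open (A \<inter> P -` ball p (\<rho> / 4))"
    using continuous_open_preimage[OF smooth_on_continuous_on[OF A(2)] A(1) open_ball] .
  then obtain \<epsilon> where \<epsilon>: "0 < \<epsilon>" "ball p \<epsilon> \<subseteq> A \<inter> P -` ball p (\<rho> / 4)"
    using germ(2,3) \<rho> openE[of "A \<inter> P -` ball p (\<rho> / 4)" p] by auto
  define \<delta> where "\<delta> = min \<epsilon> (\<rho> / 4)"
  have \<delta>: "0 < \<delta>" "\<delta> \<le> \<rho> / 4" "ball p \<delta> \<subseteq> ball p \<epsilon>" "ball p \<delta> \<subseteq> ball p \<rho>"
    using \<epsilon>(1) \<rho> by (auto simp: \<delta>_def)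
  show ?thesis
  proof (rule that[OF \<delta>(1,2) ruled_germ_subset[OF germ(1) open_ball] germ(3)])
    show "ball p \<delta> \<subseteq> A" "\<And>x. x \<in> ball p \<delta> \<Longrightarrow> P x \<in> ball p (\<rho> / 4)"
      using \<delta>(3) \<epsilon>(2) by blast+
    show "\<And>x q. x \<in> ball p \<delta> \<Longrightarrow> q \<in> S \<inter> ball p \<rho> \<Longrightarrow> x - q \<in> ruling S D q \<Longrightarrow> q = P x"
      using uniq \<delta>(4) by blast
  qed
qed

theorem exists_solution: "\<exists>M. geometric_Cauchy_solution m s S D M"
proof -
  define good where "good = (\<lambda>p P \<nu> \<rho> \<delta>. 0 < \<delta> \<and> \<delta> \<le> \<rho> / 4 \<and> ruled_germ S D (m - s) (ball p \<delta>) P \<nu> \<and> P p = p \<and>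
      (\<forall>x \<in> ball p \<delta>. P x \<in> ball p (\<rho> / 4)) \<and>
      (\<forall>x \<in> ball p \<delta>. \<forall>q \<in> S \<inter> ball p \<rho>. x - q \<in> ruling S D q \<longrightarrow> q = P x))"
  have "\<exists>P \<nu> \<rho> \<delta>. good p P \<nu> \<rho> \<delta>" if p: "p \<in> S" for p
    by (rule exists_ruled_germ[OF p]) (unfold good_def, blast)
  then obtain P \<nu> \<rho> \<delta> where good: "\<And>p. p \<in> S \<Longrightarrow> good p (P p) (\<nu> p) (\<rho> p) (\<delta> p)"
    by metis
  have \<delta>: "0 < \<delta> p" "\<delta> p \<le> \<rho> p / 4"
    and germ: "ruled_germ S D (m - s) (ball p (\<delta> p)) (P p) (\<nu> p)"
    and Pp: "P p p = p"
    and P\<rho>: "x \<in> ball p (\<delta> p) \<Longrightarrow> P p x \<in> ball p (\<rho> p / 4)"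
    and uniq: "x \<in> ball p (\<delta> p) \<Longrightarrow> q \<in> S \<inter> ball p (\<rho> p) \<Longrightarrow> x - q \<in> ruling S D q \<Longrightarrow> q = P p x"
    if "p \<in> S" for p x q
    using good[OF that] unfolding good_def by blast+
  \<comment> \<open>Of two overlapping balls, the one with the larger \<open>\<rho>\<close> sees the foot point of the other within
    its uniqueness radius; this is why \<open>\<delta>\<close> and the image of \<open>P\<close> are limited by \<open>\<rho> / 4\<close>.\<close>
  have agree_le: "P p x = P p' x"
    if p: "p \<in> S" "x \<in> ball p (\<delta> p)" and p': "p' \<in> S" "x \<in> ball p' (\<delta> p')" and le: "\<rho> p' \<le> \<rho> p" for p p' x
  proof -
    have "dist p x < \<rho> p / 4" "dist p' x < \<rho> p / 4" "dist p' (P p' x) < \<rho> p / 4"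
      using \<delta>(2)[of p] \<delta>(2)[of p'] P\<rho>[OF p'] p p' le by auto
    moreover have "0 < \<rho> p"
      using \<delta>(1,2)[OF p(1)] by linarith
    moreover have "dist p (P p' x) \<le> dist p x + dist p' x + dist p' (P p' x)"
      by (metis add_right_mono dist_triangle dist_triangle2 order_trans)
    ultimately have "P p' x \<in> ball p (\<rho> p)"
      by simp
    moreover have "P p' x \<in> S" "x - P p' x \<in> ruling S D (P p' x)"
      using germ[OF p'(1)] p'(2) by (auto simp: ruled_germ_def)
    ultimately show ?thesis
      using uniq[OF p] by simp
  qed
  have agree: "P p x = P p' x" if "p \<in> S" "x \<in> ball p (\<delta> p)" "p' \<in> S" "x \<in> ball p' (\<delta> p')" for p p' x
    using agree_le[of p x p'] agree_le[of p' x p] that by (metis linear)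
  \<comment> \<open>Membership is stated through \<open>D\<close>: normals of different balls may
    differ in sign, while \<open>D (P p x)\<close> is the same for all of them.\<close>
  define M where "M = (\<Union>p\<in>S. {x \<in> ball p (\<delta> p). x - P p x \<in> D (P p x)})"
  \<comment> \<open>Pieces from other balls add nothing inside this ball, since the foot points
    agree; so \<open>M\<close> is a single level set there.\<close>
  have MP: "M \<inter> ball p (\<delta> p) = {x \<in> ball p (\<delta> p). x - P p x \<in> D (P p x)}" if "p \<in> S" for p
  proof (intro equalityI subsetI)
    fix x assume "x \<in> M \<inter> ball p (\<delta> p)"
    then obtain p' where "p' \<in> S" "x \<in> ball p' (\<delta> p')" "x - P p' x \<in> D (P p' x)" "x \<in> ball p (\<delta> p)"
      by (auto simp: M_def)
    then show "x \<in> {x \<in> ball p (\<delta> p). x - P p x \<in> D (P p x)}"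
      using agree[OF that, of x p'] by simp
  qed (use that in \<open>auto simp: M_def\<close>)
  have hyp: "level_hypersurface M (ball p (\<delta> p)) (\<lambda>x. \<nu> p x \<bullet> (x - P p x)) (\<nu> p)" if p: "p \<in> S" for p
  proof
    show "open (ball p (\<delta> p))" "smooth_on (ball p (\<delta> p)) (\<nu> p)"
      using germ[OF p] by (auto simp: ruled_germ_def)
    have "smooth_on (ball p (\<delta> p)) (\<lambda>x. x)"
      by (rule smooth_on_linear[OF open_ball bounded_linear_ident])
    then show "smooth_on (ball p (\<delta> p)) (\<lambda>x. \<nu> p x \<bullet> (x - P p x))"
      using germ[OF p] by (intro smooth_on_inner smooth_on_diff open_ball) (auto simp: ruled_germ_def)
    show "((\<lambda>x. \<nu> p x \<bullet> (x - P p x)) has_derivative (\<lambda>y. \<nu> p z \<bullet> y)) (at z)" "\<nu> p z \<bullet> \<nu> p z = 1"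
      if "z \<in> ball p (\<delta> p)" for z
      using germ[OF p] that unfolding ruled_germ_def by blast+
    show "M \<inter> ball p (\<delta> p) = {z \<in> ball p (\<delta> p). \<nu> p z \<bullet> (z - P p z) = 0}"
      unfolding MP[OF p] using germ[OF p] unfolding ruled_germ_def by blast
  qed
  have cover: "\<exists>p\<in>S. x \<in> M \<inter> ball p (\<delta> p)" if "x \<in> M" for x
    using that by (auto simp: M_def)
  have SM: "p \<in> M \<inter> ball p (\<delta> p)" if p: "p \<in> S" for p
  proof -
    have "D p = {w. \<nu> p p \<bullet> w = 0}"
      using germ[OF p] \<delta>(1)[OF p] Pp[OF p] unfolding ruled_germ_def by (metis centre_in_ball)
    then show ?thesis
      unfolding MP[OF p] using \<delta>(1)[OF p] Pp[OF p] by simp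
  qed
  have "embedded_submanifold m M"
    unfolding embedded_submanifold_iff_slice_chart
  proof
    fix x assume "x \<in> M"
    then obtain p where p: "p \<in> S" "x \<in> M \<inter> ball p (\<delta> p)"
      using cover by blast
    interpret level_hypersurface M "ball p (\<delta> p)" "\<lambda>x. \<nu> p x \<bullet> (x - P p x)" "\<nu> p"
      by (rule hyp[OF p(1)])
    show "\<exists>U V \<phi> \<psi> L. slice_chart M U V \<phi> \<psi> L \<and> x \<in> U \<and> dim L = m"
      using slice_chart[OF p(2)] dim_hyperplane_\<nu>[of x] p(2) DIM_eq by (metis IntD2 diff_Suc_1)
  qed
  moreover have "index_of_relative_nullity M x = m - s" if x: "x \<in> M" for x
  proof -
    obtain p where p: "p \<in> S" "x \<in> M \<inter> ball p (\<delta> p)"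
      using cover[OF x] by blast
    interpret level_hypersurface M "ball p (\<delta> p)" "\<lambda>x. \<nu> p x \<bullet> (x - P p x)" "\<nu> p"
      by (rule hyp[OF p(1)])
    show ?thesis
      using index_of_relative_nullity_eq[OF p(2)] germ[OF p(1)] p(2) unfolding ruled_germ_def by simp
  qed
  moreover have "tangent_space M p = D p" if p: "p \<in> S" for p
  proof -
    interpret level_hypersurface M "ball p (\<delta> p)" "\<lambda>x. \<nu> p x \<bullet> (x - P p x)" "\<nu> p"
      by (rule hyp[OF p])
    have "D p = {w. \<nu> p p \<bullet> w = 0}"
      using germ[OF p] \<delta>(1)[OF p] Pp[OF p] unfolding ruled_germ_def by (metis centre_in_ball)
    then show ?thesis
      using tangent_space_hypersurface[OF SM[OF p]] by simp
  qed
  ultimately have "geometric_Cauchy_solution m s S D M"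
    unfolding geometric_Cauchy_solution_def rank_hypersurface_def using SM by blast
  then show ?thesis ..
qed

end

theorem corollary1p7:
  fixes m s :: nat
    and S :: "(real ^ 'n) set"
    and D :: "real ^ 'n \<Rightarrow> (real ^ 'n) set"
  assumes ambient_dim: "CARD('n) = m + 1"
    and s_bounds: "1 \<le> s" "s < m"
    and S_submanifold: "embedded_submanifold s S"
    and S_connected: "connected S"
    and D_distribution: "smooth_distribution m S D"
    and TS_subset_D: "\<forall>p\<in>S. tangent_space S p \<subseteq> D p"
    and shape_nonsingular: "\<forall>p\<in>S. \<forall>n\<in>(D p)\<^sup>\<bottom>. n \<noteq> 0 \<longrightarrow>
      bij_betw (shape_operator S D p n) (tangent_space S p) (tangent_space S p)"
  shows "\<exists>M. geometric_Cauchy_solution m s S D M"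
proof -
  interpret cauchy_data S D s m
    by unfold_locales (use assms in auto)
  show ?thesis
    by (rule exists_solution)
qed

end
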